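(* There exist constants $C > 0$ and $x_0$ such that for all real $x \ge x_0$, $$\frac{1}{x}\sum_{1\le n\le x} M(n) \le C\,(\log\log x)^3,$$ where the sum runs over positive integers $n$.
   Context: For a positive integer $m$, $s_2(m)$ denotes the number of $1$'s in the binary expansion of $m$ (the Hamming weight of $m$). For a positive integer $n$, $M(n) := \min_{k\ge 1} s_2(kn)$, the minimum being over all positive integers $k$. Here $\log$ is the natural logarithm. *)

theory Defs
  imports Complex_Main
begin

definition hamming_weight :: "nat \<Rightarrow> nat" where
  "hamming_weight m = card {i. bit m i}"

(* The infimum of a nonempty set of naturals is attained, so this is a minimum;
   Min is not applicable because infinitely many weights occur. *)
definition min_weight_multiple :: "nat \<Rightarrow> nat" where
  "min_weight_multiple n = (INF k\<in>{1..}. hamming_weight (k * n))"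

end

theory Submission
  imports Defs "HOL-Number_Theory.Number_Theory"
begin

text \<open>
  Write \<open>M\<close> for \<^const>\<open>min_weight_multiple\<close>, \<open>L = ln x\<close> and \<open>y = exp (1200 (ln L)\<^sup>2)\<close>. Hamming weight is
  submultiplicative, hence so is \<open>M\<close>; factor \<open>n = s q\<close> where \<open>q\<close> is the part of \<open>n\<close> composed of
  primes exceeding \<open>y\<close>. For all but \<open>O(x / L)\<close> of the \<open>n \<le> x\<close> (on which the trivial bound
  \<open>M(n) = O(L)\<close> suffices), \<open>n\<close> has \<open>O(ln L)\<close> prime factors and no large square divisor, so that
  \<open>ln s = O((ln L)\<^sup>3)\<close>; moreover \<open>2\<close> has order at least \<open>p\<^bsup>0.45\<^esup>\<close> modulo every prime \<open>p\<close> dividing \<open>q\<close>,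
  and \<open>gcd (p - 1) (r - 1) < L\<^sup>3\<close> for distinct primes \<open>p\<close>, \<open>r\<close> dividing \<open>n\<close>.

  For such \<open>q\<close> one has \<open>M(q) \<le> 72\<close>. Modulo \<open>p\<close> the powers of \<open>2\<close> that are \<open>1\<close> modulo \<open>q / p\<close> form a
  subgroup \<open>K\<close> of order at least \<open>p\<^bsup>0.44\<^esup>\<close>, and \<open>0\<close> is a sum of \<open>72\<close> elements of \<open>K\<close>: a sum-product
  argument with \<open>(K - K) / (K - K)\<close> together with the Ruzsa triangle inequality yields
  \<open>|6K| \<ge> p\<^bsup>0.655\<^esup>\<close>, after which each further addition of \<open>6K\<close> gains a power of \<open>p\<close> by a second
  moment bound, until \<open>36K\<close> contains at least half of all residues.
\<close>

section \<open>Hamming weights\<close>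

lemma finite_bits: "finite {i. bit (m::nat) i}"
proof (rule finite_subset[of _ "{..<m}"])
  show "{i. bit m i} \<subseteq> {..<m}"
  proof
    fix i assume "i \<in> {i. bit m i}"
    then have "m div 2 ^ i \<noteq> 0" by (auto simp: bit_iff_odd intro!: Nat.gr0I)
    then have "2 ^ i \<le> m" by (meson div_less not_le)
    then show "i \<in> {..<m}" by (simp add: less_le_trans[OF less_exp])
  qed
qed simp

lemma hamming_weight_0 [simp]: "hamming_weight 0 = 0"
  by (simp add: hamming_weight_def)

lemma hamming_weight_double [simp]: "hamming_weight (2 * m) = hamming_weight m"
proof -
  have "{i. bit (2 * m) i} = Suc ` {i. bit m i}"
    by (auto simp: bit_double_iff image_iff gr0_conv_Suc)
  then show ?thesis by (simp add: hamming_weight_def card_image)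
qed

lemma hamming_weight_double_Suc [simp]: "hamming_weight (Suc (2 * m)) = Suc (hamming_weight m)"
proof -
  have "bit (Suc (2 * m)) i \<longleftrightarrow> i = 0 \<or> i \<in> Suc ` {i. bit m i}" for i
    by (cases i) (auto simp: bit_Suc bit_0)
  then have "{i. bit (Suc (2 * m)) i} = insert 0 (Suc ` {i. bit m i})"
    by auto
  then show ?thesis
    by (simp add: hamming_weight_def card_image finite_bits)
qed

lemma hamming_weight_1 [simp]: "hamming_weight (Suc 0) = 1"
  using hamming_weight_double_Suc[of 0] by simp

lemma hamming_weight_add_le: "hamming_weight (a + b) \<le> hamming_weight a + hamming_weight b"
proof (induction "a + b" arbitrary: a b rule: less_induct)
  case less
  have "a = 2 * (a div 2) \<or> a = Suc (2 * (a div 2))" "b = 2 * (b div 2) \<or> b = Suc (2 * (b div 2))"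
    by arith+
  then obtain c d where cd: "a = 2 * c \<or> a = Suc (2 * c)" "b = 2 * d \<or> b = Suc (2 * d)"
    by blast
  consider "a = 0" | "b = 0" | "a > 0" "b > 0" by linarith
  then show ?case
  proof cases
    case 3
    have IH: "hamming_weight (c + d) \<le> hamming_weight c + hamming_weight d"
      using less(1)[of c d] 3 cd by auto
    from cd consider "a = 2 * c" "b = 2 * d" | "a = Suc (2 * c)" "b = 2 * d"
      | "a = 2 * c" "b = Suc (2 * d)" | "a = Suc (2 * c)" "b = Suc (2 * d)" by blast
    then show ?thesis
    proof cases
      case 1
      then have "a + b = 2 * (c + d)" by simp
      then show ?thesis using IH 1 by (simp only: hamming_weight_double)
    next
      case 2
      then have "a + b = Suc (2 * (c + d))" by simp
      then show ?thesis using IH 2 by (simp only: hamming_weight_double hamming_weight_double_Suc)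
    next
      case 3
      then have "a + b = Suc (2 * (c + d))" by simp
      then show ?thesis using IH 3 by (simp only: hamming_weight_double hamming_weight_double_Suc)
    next
      case 4
      \<comment> \<open>The carry out of two last digits 1 is treated as a further summand 1. As
        \<open>1 + (c + d) < a + b\<close>, the induction hypothesis applies to it too, and the
        carry costs one of the two digits just removed.\<close>
      then have "a + b = 2 * (Suc 0 + (c + d))" by simp
      then have "hamming_weight (a + b) = hamming_weight (Suc 0 + (c + d))"
        by (simp only: hamming_weight_double)
      also have "\<dots> \<le> hamming_weight (Suc 0) + hamming_weight (c + d)"
        using less(1)[of "Suc 0" "c + d"] 4 by simp
      finally show ?thesis using IH 4 by simp
    qed
  qed simp_all
qed

text \<open>Schoolbook multiplication: each digit 1 of \<open>b\<close> contributes one shifted copy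
  of \<open>a\<close>, and subadditivity bounds the weight of their sum.\<close>

lemma hamming_weight_mult_le: "hamming_weight (a * b) \<le> hamming_weight a * hamming_weight b"
proof (induction b rule: less_induct)
  case (less b)
  have "b = 2 * (b div 2) \<or> b = Suc (2 * (b div 2))" by arith
  then obtain d where "b = 2 * d \<or> b = Suc (2 * d)" by blast
  then consider "b = 0" | "b > 0" "b = 2 * d" | "b = Suc (2 * d)" by blast
  then show ?case
  proof cases
    case 2
    then have "a * b = 2 * (a * d)" by simp
    then show ?thesis using less[of d] 2 by (simp only: hamming_weight_double)
  next
    case 3
    then have "a * b = 2 * (a * d) + a" by simp
    then have "hamming_weight (a * b) \<le> hamming_weight (a * d) + hamming_weight a"
      using hamming_weight_add_le[of "2 * (a * d)" a] by simp
    also have "\<dots> \<le> hamming_weight a * hamming_weight d + hamming_weight a"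
      using less[of d] 3 by simp
    finally show ?thesis using 3 by (simp only: hamming_weight_double_Suc mult_Suc_right add.commute)
  qed simp_all
qed

lemma hamming_weight_pow2 [simp]: "hamming_weight (2 ^ k) = 1"
  by (induction k) auto

text \<open>Equal exponents are allowed, as carries only lower the weight. This turns a vanishing
  sum of 72 powers of 2 modulo \<open>q\<close> into a multiple of \<open>q\<close> of weight at
  most 72.\<close>

lemma hamming_weight_sum_pow2_le:
  assumes "finite I" shows "hamming_weight (\<Sum>i\<in>I. 2 ^ f i) \<le> card I"
  using assms
proof (induction I rule: finite_induct)
  case (insert i I)
  then show ?case using hamming_weight_add_le[of "2 ^ f i" "\<Sum>i\<in>I. 2 ^ f i"] by simp
qed simp

lemma hamming_weight_le_if_less_pow2:
  assumes "m < 2 ^ k" shows "hamming_weight m \<le> k"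
proof -
  have "{i. bit m i} \<subseteq> {..<k}"
  proof
    fix i assume "i \<in> {i. bit m i}"
    then have "m div 2 ^ i \<noteq> 0" by (auto simp: bit_iff_odd intro!: Nat.gr0I)
    then have "2 ^ i \<le> m" by (meson div_less not_le)
    then have "(2::nat) ^ i < 2 ^ k" using assms by linarith
    then show "i \<in> {..<k}" by simp
  qed
  then show ?thesis unfolding hamming_weight_def by (metis card_lessThan card_mono finite_lessThan)
qed

section \<open>Least weight of a positive multiple\<close>

lemma min_weight_multiple_le:
  assumes "n dvd m" "m > 0" shows "min_weight_multiple n \<le> hamming_weight m"
proof -
  from assms obtain k where "m = k * n" "k \<ge> 1" by (metis dvdE mult.commute mult_0_right not_less_zero less_one not_le)
  then show ?thesis unfolding min_weight_multiple_def by (auto intro: cINF_lower)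
qed

lemma min_weight_multiple_attained:
  obtains k where "k \<ge> 1" "min_weight_multiple n = hamming_weight (k * n)"
proof -
  have "(INF k\<in>{1..}. hamming_weight (k * n)) \<in> (\<lambda>k. hamming_weight (k * n)) ` {1..}"
    by (rule Inf_nat_def1) auto
  then show ?thesis using that unfolding min_weight_multiple_def by auto
qed

lemma min_weight_multiple_mult_le:
  assumes "a > 0" "b > 0"
  shows "min_weight_multiple (a * b) \<le> min_weight_multiple a * min_weight_multiple b"
proof -
  obtain k where k: "k \<ge> 1" "min_weight_multiple a = hamming_weight (k * a)"
    by (rule min_weight_multiple_attained)
  obtain l where l: "l \<ge> 1" "min_weight_multiple b = hamming_weight (l * b)"
    by (rule min_weight_multiple_attained)
  have "min_weight_multiple (a * b) \<le> hamming_weight ((k * a) * (l * b))"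
    using assms k l by (intro min_weight_multiple_le) auto
  also have "\<dots> \<le> min_weight_multiple a * min_weight_multiple b"
    unfolding k l by (rule hamming_weight_mult_le)
  finally show ?thesis .
qed

lemma min_weight_multiple_le_log:
  assumes "n > 0" shows "real (min_weight_multiple n) \<le> ln n / ln 2 + 1"
proof -
  define k where "k = nat \<lfloor>log 2 n\<rfloor> + 1"
  have "n < 2 ^ k"
  proof -
    have "log 2 n < real k" using assms unfolding k_def
      by (simp add: nat_add_distrib) linarith
    then have "real n < 2 powr real k" using assms by (simp add: log_less_iff)
    then show ?thesis by (simp add: powr_realpow)
  qed
  then have "min_weight_multiple n \<le> k"
    using min_weight_multiple_le[of n n] assms hamming_weight_le_if_less_pow2 by fastforce
  also have "real k \<le> log 2 n + 1"
  proof -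
    have "0 \<le> log 2 n" using assms by simp
    then show ?thesis unfolding k_def by simp
  qed
  finally show ?thesis by (simp add: log_def)
qed

section \<open>Sumsets modulo a prime\<close>

lemma power2_sum_le_card_mult_sum_power2:
  fixes f :: "'a \<Rightarrow> real"
  assumes "finite I"
  shows "(\<Sum>i\<in>I. f i)\<^sup>2 \<le> card I * (\<Sum>i\<in>I. (f i)\<^sup>2)"
proof (cases "I = {}")
  case False
  define n S where "n = real (card I)" and "S = (\<Sum>i\<in>I. f i)"
  have n: "n > 0" using False assms by (simp add: n_def card_gt_0_iff)
  \<comment> \<open>The deviations from the mean are scaled by \<open>n\<close>; the sum of their
    squares expands to \<open>n\<close> times the claimed difference.\<close>
  have "0 \<le> (\<Sum>i\<in>I. (n * f i - S)\<^sup>2)" by (intro sum_nonneg) auto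
  also have "\<dots> = (\<Sum>i\<in>I. n\<^sup>2 * (f i)\<^sup>2 - 2 * n * S * f i + S\<^sup>2)"
    by (intro sum.cong) (auto simp: power2_eq_square algebra_simps)
  also have "\<dots> = n\<^sup>2 * (\<Sum>i\<in>I. (f i)\<^sup>2) - 2 * n * S * S + n * S\<^sup>2"
    by (simp add: sum.distrib sum_subtractf sum_distrib_left [symmetric] n_def S_def mult.assoc)
  also have "\<dots> = n * (n * (\<Sum>i\<in>I. (f i)\<^sup>2) - S\<^sup>2)"
    by (simp add: power2_eq_square algebra_simps)
  finally show ?thesis using n by (simp add: zero_le_mult_iff n_def S_def)
qed auto

text \<open>The fibres of \<open>f\<close> partition \<open>S\<close>, and the number of collisions
  is the sum of the squares of the fibre sizes, so Cauchy-Schwarz over the image applies.\<close>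

lemma card_power2_le_card_image_mult_collisions:
  assumes "finite S"
  shows "(card S)\<^sup>2 \<le> card (f ` S) * card {(s, s'). s \<in> S \<and> s' \<in> S \<and> f s = f s'}"
proof -
  define F where "F = (\<lambda>y. {s \<in> S. f s = y})"
  have fin: "finite (F y)" for y using assms by (auto simp: F_def)
  have "S = (\<Union>y\<in>f ` S. F y)" by (auto simp: F_def)
  then have "card S = card (\<Union>y\<in>f ` S. F y)" by simp
  also have "\<dots> = (\<Sum>y\<in>f ` S. card (F y))"
    using assms fin by (intro card_UN_disjoint) (auto simp: F_def)
  finally have 1: "card S = (\<Sum>y\<in>f ` S. card (F y))" .
  have "{(s, s'). s \<in> S \<and> s' \<in> S \<and> f s = f s'} = (\<Union>y\<in>f ` S. F y \<times> F y)"
    by (auto simp: F_def)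
  then have "card {(s, s'). s \<in> S \<and> s' \<in> S \<and> f s = f s'} = card (\<Union>y\<in>f ` S. F y \<times> F y)"
    by (rule arg_cong)
  also have "\<dots> = (\<Sum>y\<in>f ` S. card (F y \<times> F y))"
    using assms fin by (intro card_UN_disjoint) (auto simp: F_def)
  finally have 2: "card {(s, s'). s \<in> S \<and> s' \<in> S \<and> f s = f s'} = (\<Sum>y\<in>f ` S. (card (F y))\<^sup>2)"
    by (simp add: card_cartesian_product power2_eq_square)
  have "(\<Sum>y\<in>f ` S. real (card (F y)))\<^sup>2 \<le> card (f ` S) * (\<Sum>y\<in>f ` S. (real (card (F y)))\<^sup>2)"
    using assms by (intro power2_sum_le_card_mult_sum_power2) auto
  then have "real ((card S)\<^sup>2) \<le> real (card (f ` S) * (\<Sum>y\<in>f ` S. (card (F y))\<^sup>2))"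
    by (simp add: 1)
  then show ?thesis unfolding 2 of_nat_le_iff .
qed

definition sumset_mod :: "int \<Rightarrow> int set \<Rightarrow> int set \<Rightarrow> int set" where
  "sumset_mod p A B = (\<lambda>(a, b). (a + b) mod p) ` (A \<times> B)"

text \<open>For residue sets \<open>A\<close>, \<open>X\<close> and \<open>z\<close> prime to
  \<open>p\<close>, the cardinality is the additive energy of \<open>A\<close> and the dilate
  \<open>z X\<close> modulo \<open>p\<close>.\<close>

definition collisions :: "int \<Rightarrow> int set \<Rightarrow> int set \<Rightarrow> int \<Rightarrow> ((int \<times> int) \<times> (int \<times> int)) set" where
  "collisions p A X z = {(s, s'). s \<in> A \<times> X \<and> s' \<in> A \<times> X \<and>
     (case s of (a, x) \<Rightarrow> (a + z * x) mod p) = (case s' of (a, x) \<Rightarrow> (a + z * x) mod p)}"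

lemma cong_imp_eq_residue:
  fixes a b p :: int
  assumes "a \<in> {0..<p}" "b \<in> {0..<p}" "p dvd a - b" shows "a = b"
  using assms by (metis atLeastLessThan_iff mod_eq_dvd_iff mod_pos_pos_trivial)

text \<open>Double counting: a pair of distinct points of \<open>A \<times> X\<close> collides for
  at most one residue \<open>z\<close>, an equal pair for all \<open>p\<close> of them.\<close>

lemma sum_card_collisions_le:
  assumes p: "prime p" and A: "A \<subseteq> {0..<p}" and X: "X \<subseteq> {0..<p}"
  shows "(\<Sum>z\<in>{0..<p}. card (collisions p A X z)) \<le> (card A * card X)\<^sup>2 + nat p * (card A * card X)"
proof -
  define Q where "Q = (A \<times> X) \<times> (A \<times> X)"
  have finA: "finite A" and finX: "finite X" using A X finite_subset by blast+
  have fin: "finite Q" using finA finX by (auto simp: Q_def)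
  define T where "T = (\<lambda>q. {z \<in> {0..<p}. q \<in> collisions p A X z})"
  have sub: "collisions p A X z \<subseteq> Q" for z by (auto simp: collisions_def Q_def)
  have "(\<Sum>z\<in>{0..<p}. card (collisions p A X z)) = (\<Sum>z\<in>{0..<p}. \<Sum>q\<in>Q. if q \<in> collisions p A X z then 1 else 0)"
  proof (intro sum.cong refl)
    fix z
    show "card (collisions p A X z) = (\<Sum>q\<in>Q. if q \<in> collisions p A X z then 1 else 0)"
      using sub[of z] fin by (simp add: sum.If_cases Int_absorb1)
  qed
  also have "\<dots> = (\<Sum>q\<in>Q. \<Sum>z\<in>{0..<p}. if q \<in> collisions p A X z then 1 else 0)"
    by (rule sum.swap)
  also have "\<dots> = (\<Sum>q\<in>Q. card (T q))"
    by (intro sum.cong refl) (simp add: sum.If_cases T_def Int_def)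
  also have "\<dots> \<le> (\<Sum>q\<in>Q. 1 + (if fst q = snd q then nat p else 0))"
  proof (intro sum_mono)
    fix q assume q: "q \<in> Q"
    then obtain a x b y where q_eq: "q = ((a, x), (b, y))" and mem: "a \<in> A" "x \<in> X" "b \<in> A" "y \<in> X"
      by (auto simp: Q_def)
    show "card (T q) \<le> 1 + (if fst q = snd q then nat p else 0)"
    proof (cases "fst q = snd q")
      case True
      have "card (T q) \<le> card {0..<p}" by (intro card_mono) (auto simp: T_def)
      then show ?thesis using True by simp
    next
      case False
      have "z = w" if z: "z \<in> T q" and w: "w \<in> T q" for z w
      proof -
        have "(a + z * x) mod p = (b + z * y) mod p" "(a + w * x) mod p = (b + w * y) mod p"
          using z w by (auto simp: T_def q_eq collisions_def)
        then have d: "p dvd (a + z * x) - (b + z * y)" "p dvd (a + w * x) - (b + w * y)"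
          by (simp_all add: mod_eq_dvd_iff)
        \<comment> \<open>Subtracting the two relations eliminates \<open>a\<close> and
          \<open>b\<close>.\<close>
        then have "p dvd ((a + z * x) - (b + z * y)) - ((a + w * x) - (b + w * y))"
          by (rule dvd_diff)
        also have "((a + z * x) - (b + z * y)) - ((a + w * x) - (b + w * y)) = (z - w) * (x - y)"
          by (simp add: algebra_simps)
        finally have "p dvd z - w \<or> p dvd x - y" using p by (simp add: prime_dvd_mult_iff)
        then show ?thesis
        proof
          assume "p dvd z - w"
          then show ?thesis using z w by (intro cong_imp_eq_residue) (auto simp: T_def)
        next
          assume "p dvd x - y"
          then have xy: "x = y" using mem X by (intro cong_imp_eq_residue) auto
          with d(1) have "p dvd a - b" by simp
          then have "a = b" using mem A by (intro cong_imp_eq_residue) auto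
          with xy False q_eq show ?thesis by simp
        qed
      qed
      moreover have "finite (T q)"
        by (rule finite_subset[of _ "{0..<p}"]) (auto simp: T_def)
      ultimately have "card (T q) \<le> 1"
        by (metis One_nat_def card_le_Suc0_iff_eq)
      then show ?thesis by simp
    qed
  qed
  also have "\<dots> = card Q + card {q \<in> Q. fst q = snd q} * nat p"
    by (subst sum.distrib) (use fin in \<open>simp add: sum.If_cases Int_def\<close>)
  also have "{q \<in> Q. fst q = snd q} = (\<lambda>s. (s, s)) ` (A \<times> X)"
    by (auto simp: Q_def)
  also have "card \<dots> = card A * card X"
    by (simp add: card_image inj_on_def card_cartesian_product)
  also have "card Q = (card A * card X)\<^sup>2"
    by (simp add: Q_def card_cartesian_product power2_eq_square)
  finally show ?thesis by (simp add: mult.commute)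
qed

lemma card_image_mult_collisions_ge:
  assumes "A \<subseteq> {0..<p}" "X \<subseteq> {0..<p}"
  shows "(card A * card X)\<^sup>2 \<le> card ((\<lambda>(a, x). (a + z * x) mod p) ` (A \<times> X)) * card (collisions p A X z)"
proof -
  have "finite (A \<times> X)" using assms finite_subset by blast
  from card_power2_le_card_image_mult_collisions[OF this, of "\<lambda>(a, x). (a + z * x) mod p"]
  show ?thesis by (simp add: collisions_def card_cartesian_product)
qed

text \<open>All dilations of \<^term>\<open>X\<close> by elements of \<^term>\<open>K\<close> give the same sumset, so they all have at
  least \<open>S\<^sup>2/c\<close> collisions, while every dilation has at least \<open>S\<^sup>2/p\<close>; compare with the total.\<close>

lemma card_sumset_mod_invariant_ge:
  fixes p :: int
  assumes p: "prime p" and A: "A \<subseteq> {0..<p}" "A \<noteq> {}" and X: "X \<subseteq> {0..<p}" "X \<noteq> {}"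
    and K: "K \<subseteq> {0..<p}" and inv: "\<And>k x. k \<in> K \<Longrightarrow> x \<in> X \<Longrightarrow> (k * x) mod p \<in> X"
  shows "real (card (sumset_mod p A X)) \<ge> min p (card A * card X * card K / p) / 2"
proof -
  define S where "S = real (card A * card X)"
  define c where "c = real (card (sumset_mod p A X))"
  define k where "k = real (card K)"
  define P where "P = real_of_int p"
  have p0: "p > 0" using p by (simp add: prime_gt_0_int)
  have P: "P > 0" using p0 by (simp add: P_def)
  have fin: "finite A" "finite X" "finite K" using A X K finite_subset by blast+
  have S0: "S > 0" using A X fin by (simp add: S_def card_gt_0_iff)
  have finS: "finite (sumset_mod p A X)" using fin by (simp add: sumset_mod_def)
  have c0: "c > 0" using A X finS by (auto simp: c_def card_gt_0_iff sumset_mod_def)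
  define E where "E = (\<lambda>z. real (card (collisions p A X z)))"
  have E_c: "S\<^sup>2 / c \<le> E z" if z: "z \<in> K" for z
  proof -
    have "(\<lambda>(a, x). (a + z * x) mod p) ` (A \<times> X) \<subseteq> sumset_mod p A X"
    proof safe
      fix a x assume "a \<in> A" "x \<in> X"
      then have "(a + (z * x) mod p) mod p \<in> sumset_mod p A X"
        using inv[OF z] unfolding sumset_mod_def by (intro image_eqI[where x = "(a, (z * x) mod p)"]) auto
      then show "(a + z * x) mod p \<in> sumset_mod p A X" by (simp add: mod_simps)
    qed
    then have "card ((\<lambda>(a, x). (a + z * x) mod p) ` (A \<times> X)) \<le> card (sumset_mod p A X)"
      using finS by (intro card_mono)
    then have "(card A * card X)\<^sup>2 \<le> card (sumset_mod p A X) * card (collisions p A X z)"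
      using card_image_mult_collisions_ge[OF A(1) X(1), of z] by (meson le_trans mult_le_mono1)
    then have "real ((card A * card X)\<^sup>2) \<le> real (card (sumset_mod p A X) * card (collisions p A X z))"
      using of_nat_le_iff by blast
    then have "S\<^sup>2 \<le> c * E z" by (simp add: S_def c_def E_def)
    then show ?thesis using c0 by (simp add: field_simps)
  qed
  have E_P: "S\<^sup>2 / P \<le> E z" for z
  proof -
    have "(\<lambda>(a, x). (a + z * x) mod p) ` (A \<times> X) \<subseteq> {0..<p}" using p0 by auto
    then have "card ((\<lambda>(a, x). (a + z * x) mod p) ` (A \<times> X)) \<le> nat p"
      by (metis card_atLeastLessThan_int card_mono diff_zero finite_atLeastLessThan_int)
    then have "(card A * card X)\<^sup>2 \<le> nat p * card (collisions p A X z)"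
      using card_image_mult_collisions_ge[OF A(1) X(1), of z] by (meson le_trans mult_le_mono1)
    then have "real ((card A * card X)\<^sup>2) \<le> real (nat p * card (collisions p A X z))"
      using of_nat_le_iff by blast
    then have "S\<^sup>2 \<le> P * E z" using p0 by (simp add: S_def P_def E_def)
    then show ?thesis using P by (simp add: field_simps)
  qed
  have "k * (S\<^sup>2 / c) + (P - k) * (S\<^sup>2 / P) = (\<Sum>z\<in>K. S\<^sup>2 / c) + (\<Sum>z\<in>{0..<p} - K. S\<^sup>2 / P)"
    using K fin p0 card_mono[OF _ K] by (simp add: k_def P_def card_Diff_subset of_nat_diff)
  also have "\<dots> \<le> (\<Sum>z\<in>K. E z) + (\<Sum>z\<in>{0..<p} - K. E z)"
    by (intro add_mono sum_mono E_c E_P)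
  also have "\<dots> = (\<Sum>z\<in>{0..<p}. E z)"
    using K by (simp add: sum.subset_diff)
  also have "\<dots> = real (\<Sum>z\<in>{0..<p}. card (collisions p A X z))"
    by (simp add: E_def)
  also have "\<dots> \<le> real ((card A * card X)\<^sup>2 + nat p * (card A * card X))"
    using sum_card_collisions_le[OF p A(1) X(1)] of_nat_le_iff by blast
  also have "\<dots> = S\<^sup>2 + P * S" using p0 by (simp add: S_def P_def)
  finally have "k * S\<^sup>2 / c \<le> k * S\<^sup>2 / P + P * S" using P by (simp add: field_simps)
  then have "S * (k * S / c) \<le> S * (k * S / P + P)" by (simp add: power2_eq_square algebra_simps)
  then have "k * S / c \<le> k * S / P + P" using S0 by (simp only: mult_le_cancel_left_pos)
  also have "x + y \<le> 2 * max x y" for x y :: real by simp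
  finally have "k * S / c \<le> 2 * max (k * S / P) P" .
  then have "k * S \<le> 2 * max (k * S / P) P * c" using c0 by (simp add: field_simps)
  \<comment> \<open>The first alternative gives \<open>c \<ge> P / 2\<close>, the second
    \<open>c \<ge> k S / (2 P)\<close>; together they yield the minimum in the claim.\<close>
  then have *: "k * S \<le> 2 * (k * S / P) * c \<or> k * S \<le> 2 * P * c" by (simp add: max_def split: if_splits)
  show ?thesis
  proof (cases "k = 0")
    case True
    then show ?thesis using P by (simp add: k_def P_def)
  next
    case False
    then have "k * S > 0" using S0 by (simp add: k_def)
    have "P \<le> 2 * c \<or> k * S / P \<le> 2 * c"
      using *
    proof
      assume "k * S \<le> 2 * (k * S / P) * c"
      then have "(k * S) * P \<le> (k * S) * (2 * c)" using P by (simp add: field_simps)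
      then have "P \<le> 2 * c" using \<open>k * S > 0\<close> by (simp only: mult_le_cancel_left_pos)
      then show ?thesis ..
    next
      assume "k * S \<le> 2 * P * c"
      then show ?thesis using P by (simp add: field_simps)
    qed
    then show ?thesis by (auto simp: P_def k_def S_def c_def algebra_simps)
  qed
qed

section \<open>Iterated sumsets of a multiplicatively closed set\<close>

primrec iter_sumset :: "int \<Rightarrow> int set \<Rightarrow> nat \<Rightarrow> int set" where
  "iter_sumset p K 0 = {0}"
| "iter_sumset p K (Suc n) = sumset_mod p K (iter_sumset p K n)"

lemma iter_sumset_subset: "p > 0 \<Longrightarrow> iter_sumset p K n \<subseteq> {0..<p}"
  by (cases n) (auto simp: sumset_mod_def)

lemma finite_iter_sumset: "p > 0 \<Longrightarrow> finite (iter_sumset p K n)"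
  by (rule finite_subset[OF iter_sumset_subset]) auto

lemma iter_sumset_nonempty: "K \<noteq> {} \<Longrightarrow> iter_sumset p K n \<noteq> {}"
  by (induction n) (auto simp: sumset_mod_def)

lemma iter_sumset_SucI: "k \<in> K \<Longrightarrow> x \<in> iter_sumset p K n \<Longrightarrow> (k + x) mod p \<in> iter_sumset p K (Suc n)"
  by (auto simp: sumset_mod_def)

lemma iter_sumset_SucE:
  assumes "x \<in> iter_sumset p K (Suc n)"
  obtains k y where "k \<in> K" "y \<in> iter_sumset p K n" "x = (k + y) mod p"
  using assms by (auto simp: sumset_mod_def)

lemma iter_sumset_add:
  assumes "x \<in> iter_sumset p K m" "y \<in> iter_sumset p K n" "p > 0"
  shows "(x + y) mod p \<in> iter_sumset p K (m + n)"
  using assms(1)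
proof (induction m arbitrary: x)
  case 0
  then have "x = 0" by simp
  moreover have "y \<in> {0..<p}" using assms iter_sumset_subset by blast
  ultimately show ?case using assms by simp
next
  case (Suc m)
  then obtain k z where kz: "k \<in> K" "z \<in> iter_sumset p K m" "x = (k + z) mod p"
    by (elim iter_sumset_SucE)
  have "(k + (z + y) mod p) mod p \<in> iter_sumset p K (Suc (m + n))"
    by (intro iter_sumset_SucI kz Suc.IH)
  then show ?case by (simp add: kz mod_simps add.assoc)
qed

lemma sumset_mod_iter_sumset_subset:
  "p > 0 \<Longrightarrow> sumset_mod p (iter_sumset p K m) (iter_sumset p K n) \<subseteq> iter_sumset p K (m + n)"
  using iter_sumset_add by (auto simp: sumset_mod_def)

text \<open>Multiplication by \<open>k\<close> distributes over the summands. This supplies the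
  invariance under \<open>K\<close> that \<open>card_sumset_mod_invariant_ge\<close> asks of its set
  \<open>X\<close>.\<close>

lemma iter_sumset_mult:
  assumes K: "\<And>k l. k \<in> K \<Longrightarrow> l \<in> K \<Longrightarrow> (k * l) mod p \<in> K"
    and k: "k \<in> K" and x: "x \<in> iter_sumset p K n"
  shows "(k * x) mod p \<in> iter_sumset p K n"
  using x
proof (induction n arbitrary: x)
  case (Suc n)
  then obtain l y where ly: "l \<in> K" "y \<in> iter_sumset p K n" "x = (l + y) mod p"
    by (elim iter_sumset_SucE)
  have "((k * l) mod p + (k * y) mod p) mod p \<in> iter_sumset p K (Suc n)"
    by (intro iter_sumset_SucI K k ly Suc.IH)
  moreover have "((k * l) mod p + (k * y) mod p) mod p = (k * x) mod p"
    unfolding ly by (simp add: mod_simps distrib_left)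
  ultimately show ?case by simp
qed auto

lemma iter_sumset_imp_sum:
  assumes "x \<in> iter_sumset p K n"
  shows "\<exists>g. (\<forall>i<n. g i \<in> K) \<and> x = (\<Sum>i<n. g i) mod p"
  using assms
proof (induction n arbitrary: x)
  case (Suc n)
  then obtain k y where ky: "k \<in> K" "y \<in> iter_sumset p K n" "x = (k + y) mod p"
    by (elim iter_sumset_SucE)
  then obtain g where g: "\<forall>i<n. g i \<in> K" "y = (\<Sum>i<n. g i) mod p"
    using Suc.IH[OF ky(2)] by blast
  have "(\<forall>i<Suc n. (g(n := k)) i \<in> K) \<and> x = (\<Sum>i<Suc n. (g(n := k)) i) mod p"
    using ky g by (auto simp: mod_simps add.commute)
  then show ?case by blast
qed auto

section \<open>Sum-product estimate with the quotient set\<close>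

lemma exists_large_dilate_sum:
  fixes p :: int
  assumes p: "prime p" and A: "A \<subseteq> {0..<p}" "A \<noteq> {}"
  shows "\<exists>z\<in>{0..<p}. real (card ((\<lambda>(a, x). (a + z * x) mod p) ` (A \<times> A))) \<ge> min (real_of_int p) (real ((card A)\<^sup>2)) / 2"
proof -
  define S where "S = real (card A * card A)"
  define P where "P = real_of_int p"
  have p0: "p > 0" using p by (simp add: prime_gt_0_int)
  have P: "P > 0" using p0 by (simp add: P_def)
  have fin: "finite A" using A finite_subset by blast
  have S0: "S > 0" using A fin by (simp add: S_def card_gt_0_iff)
  define E where "E = (\<lambda>z. real (card (collisions p A A z)))"
  have sumE: "(\<Sum>z\<in>{0..<p}. E z) \<le> S\<^sup>2 + P * S"
  proof -
    have "(\<Sum>z\<in>{0..<p}. E z) = real (\<Sum>z\<in>{0..<p}. card (collisions p A A z))"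
      by (simp add: E_def)
    also have "\<dots> \<le> real ((card A * card A)\<^sup>2 + nat p * (card A * card A))"
      using sum_card_collisions_le[OF p A(1) A(1)] of_nat_le_iff by blast
    also have "\<dots> = S\<^sup>2 + P * S" using p0 by (simp add: S_def P_def)
    finally show ?thesis .
  qed
  \<comment> \<open>By averaging over all residues, some \<open>z\<close> has at most the mean
    number \<open>S^2 / P + S\<close> of collisions.\<close>
  have "\<exists>z\<in>{0..<p}. E z \<le> (S\<^sup>2 + P * S) / P"
  proof (rule ccontr)
    assume "\<not> ?thesis"
    then have "(\<Sum>z\<in>{0..<p}. (S\<^sup>2 + P * S) / P) < (\<Sum>z\<in>{0..<p}. E z)"
      using p0 by (intro sum_strict_mono) (auto simp: not_le)
    then show False using sumE p0 by (simp add: P_def)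
  qed
  then obtain z where z: "z \<in> {0..<p}" "E z \<le> (S\<^sup>2 + P * S) / P" by blast
  define c where "c = real (card ((\<lambda>(a, x). (a + z * x) mod p) ` (A \<times> A)))"
  have c0: "c \<ge> 0" by (simp add: c_def)
  have "real ((card A * card A)\<^sup>2) \<le> real (card ((\<lambda>(a, x). (a + z * x) mod p) ` (A \<times> A)) * card (collisions p A A z))"
    using card_image_mult_collisions_ge[OF A(1) A(1), of z] of_nat_le_iff by blast
  then have "S\<^sup>2 \<le> c * E z" by (simp add: S_def c_def E_def)
  also have "\<dots> \<le> c * ((S\<^sup>2 + P * S) / P)" using z c0 by (intro mult_left_mono)
  also have "\<dots> = S * (c * (S + P) / P)" by (simp add: power2_eq_square algebra_simps)
  finally have "S * S \<le> S * (c * (S + P) / P)" by (simp only: power2_eq_square)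
  then have "S \<le> c * (S + P) / P" using S0 by (simp only: mult_le_cancel_left_pos)
  then have "S * P \<le> c * (S + P)" using P by (simp add: field_simps)
  also have "\<dots> \<le> c * (2 * max S P)" using c0 by (intro mult_left_mono) auto
  finally have SP: "S * P \<le> c * (2 * max S P)" .
  have "min P S \<le> 2 * c"
  proof (cases "S \<le> P")
    case True
    with SP have "P * S \<le> P * (2 * c)" by (simp add: max_def algebra_simps)
    then show ?thesis using P True by (simp only: mult_le_cancel_left_pos min_def) auto
  next
    case False
    with SP have "S * P \<le> S * (2 * c)" by (simp add: max_def algebra_simps)
    then show ?thesis using S0 False by (simp only: mult_le_cancel_left_pos min_def) auto
  qed
  moreover have "S = real ((card A)\<^sup>2)" by (simp add: S_def power2_eq_square)
  ultimately have "c \<ge> min (real_of_int p) (real ((card A)\<^sup>2)) / 2" by (simp add: P_def)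
  then show ?thesis using z(1) unfolding c_def by blast
qed

text \<open>Dichotomy for the quotient set \<open>(K - K) / (K - K)\<close> modulo \<open>p\<close>:
  either it is not closed under adding 1, and an escaping \<open>r + 1\<close> makes
  \<open>a + z x\<close> injective on \<open>K \<times> K\<close>, or it contains every residue,
  among them the \<open>z\<close> found by averaging. Both times \<open>z\<close> is a quotient with
  numerator in \<open>K + K - K - K\<close>, which keeps the later sums short.\<close>

lemma exists_large_dilate_sum_quotient:
  fixes p :: int
  assumes p: "prime p" and K: "K \<subseteq> {0..<p}" "card K \<ge> 2"
  shows "\<exists>z a a' b b' c d. a \<in> K \<and> a' \<in> K \<and> b \<in> K \<and> b' \<in> K \<and> c \<in> K \<and> d \<in> K \<and> c \<noteq> d \<and>
    p dvd (c - d) * z - (a + a' - b - b') \<and>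
    real (card ((\<lambda>(a, x). (a + z * x) mod p) ` (K \<times> K))) \<ge> min (real_of_int p) (real ((card K)\<^sup>2)) / 2"
proof -
  have p0: "p > 0" using p by (simp add: prime_gt_0_int)
  define R where "R = {z. \<exists>a b c d. a \<in> K \<and> b \<in> K \<and> c \<in> K \<and> d \<in> K \<and> c \<noteq> d \<and> p dvd (c - d) * z - (a - b)}"
  obtain k l where kl: "k \<in> K" "l \<in> K" "k \<noteq> l"
    using K(2) by (metis card_le_Suc0_iff_eq card.infinite not_less_eq_eq numeral_2_eq_2 zero_le)
  have R0: "0 \<in> R" unfolding R_def using kl by force
  show ?thesis
  proof (cases "\<exists>r. r \<in> R \<and> r + 1 \<notin> R")
    case True
    then obtain r where r: "r \<in> R" "r + 1 \<notin> R" by blast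
    from r(1) obtain a b c d where abcd: "a \<in> K" "b \<in> K" "c \<in> K" "d \<in> K" "c \<noteq> d"
      and dvd: "p dvd (c - d) * r - (a - b)" unfolding R_def by blast
    \<comment> \<open>A collision with \<open>x \<noteq> x'\<close> would exhibit
      \<open>r + 1\<close> as the quotient \<open>(a' - a) / (x - x')\<close>.\<close>
    have "inj_on (\<lambda>(a, x). (a + (r + 1) * x) mod p) (K \<times> K)"
    proof (intro inj_onI)
      fix s s' assume s: "s \<in> K \<times> K" "s' \<in> K \<times> K"
        and eq: "(case s of (a, x) \<Rightarrow> (a + (r + 1) * x) mod p) = (case s' of (a, x) \<Rightarrow> (a + (r + 1) * x) mod p)"
      obtain a x a' x' where ss: "s = (a, x)" "s' = (a', x')" by (cases s, cases s')
      have d: "p dvd (a + (r + 1) * x) - (a' + (r + 1) * x')"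
        using eq unfolding ss by (simp add: mod_eq_dvd_iff)
      have "x = x'"
      proof (rule ccontr)
        assume "x \<noteq> x'"
        have eq: "(a + (r + 1) * x) - (a' + (r + 1) * x') = (x - x') * (r + 1) - (a' - a)"
          by (simp add: algebra_simps)
        have "p dvd (x - x') * (r + 1) - (a' - a)" using d unfolding eq .
        with \<open>x \<noteq> x'\<close> s have "r + 1 \<in> R" unfolding R_def ss by blast
        with r show False by simp
      qed
      with d have "p dvd a - a'" by simp
      then have "a = a'" using s K ss by (intro cong_imp_eq_residue) auto
      with \<open>x = x'\<close> show "s = s'" by (simp add: ss)
    qed
    then have "card ((\<lambda>(a, x). (a + (r + 1) * x) mod p) ` (K \<times> K)) = (card K)\<^sup>2"
      by (simp add: card_image card_cartesian_product power2_eq_square)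
    then have "real (card ((\<lambda>(a, x). (a + (r + 1) * x) mod p) ` (K \<times> K))) \<ge> min (real_of_int p) (real ((card K)\<^sup>2)) / 2"
      by linarith
    \<comment> \<open>The quotient \<open>(a - b) / (c - d) + 1\<close> has numerator
      \<open>a + c - b - d\<close>.\<close>
    moreover have eq: "(c - d) * (r + 1) - (a + c - b - d) = (c - d) * r - (a - b)"
      by (simp add: algebra_simps)
    have "p dvd (c - d) * (r + 1) - (a + c - b - d)" using dvd unfolding eq .
    ultimately show ?thesis using abcd
      by (intro exI[of _ "r + 1"] exI[of _ a] exI[of _ c] exI[of _ b] exI[of _ d] exI[of _ c] exI[of _ d] conjI)
  next
    case False
    \<comment> \<open>Containing 0 and closed under successor, \<open>R\<close> contains all
      residues.\<close>
    have "int n \<in> R" for n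
      by (induction n) (use R0 False in \<open>auto simp: add.commute\<close>)
    then have R: "z \<in> R" if "z \<ge> 0" for z using that by (metis int_nat_eq)
    obtain z where z: "z \<in> {0..<p}"
      "real (card ((\<lambda>(a, x). (a + z * x) mod p) ` (K \<times> K))) \<ge> min (real_of_int p) (real ((card K)\<^sup>2)) / 2"
      using exists_large_dilate_sum[OF p K(1)] kl by blast
    then have "z \<in> R" using R by auto
    then obtain a b c d where "a \<in> K" "b \<in> K" "c \<in> K" "d \<in> K" "c \<noteq> d"
      and "p dvd (c - d) * z - (a - b)" unfolding R_def by blast
    \<comment> \<open>Padding with \<open>c - c\<close> gives the quotient the four-term numerator
      of the other case.\<close>
    moreover from this(6) have "p dvd (c - d) * z - (a + c - b - c)" by simp
    ultimately show ?thesis using z(2)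
      by (intro exI[of _ z] exI[of _ a] exI[of _ c] exI[of _ b] exI[of _ c] exI[of _ c] exI[of _ d] conjI)
  qed
qed

text \<open>Multiplying a value \<open>k + z x\<close> by \<open>c - d\<close> clears the
  denominator of \<open>z\<close> and yields \<open>(c k + a x + a' x) - (d k + b x + b' x)\<close>,
  a difference of two three-fold sums. The map is injective because \<open>c - d\<close> is
  invertible modulo \<open>p\<close>.\<close>

lemma card_diffset_three_fold_ge:
  fixes p :: int
  assumes p: "prime p" and K: "K \<subseteq> {0..<p}" "card K \<ge> 2"
    and mult: "\<And>k l. k \<in> K \<Longrightarrow> l \<in> K \<Longrightarrow> (k * l) mod p \<in> K"
  shows "real (card ((\<lambda>(a, b). (a - b) mod p) ` (iter_sumset p K 3 \<times> iter_sumset p K 3))) \<ge> min (real_of_int p) (real ((card K)\<^sup>2)) / 2"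
proof -
  have p0: "p > 0" using p by (simp add: prime_gt_0_int)
  obtain z a a' b b' c d where mem: "a \<in> K" "a' \<in> K" "b \<in> K" "b' \<in> K" "c \<in> K" "d \<in> K" "c \<noteq> d"
    and dvd: "p dvd (c - d) * z - (a + a' - b - b')"
    and card: "real (card ((\<lambda>(a, x). (a + z * x) mod p) ` (K \<times> K))) \<ge> min (real_of_int p) (real ((card K)\<^sup>2)) / 2"
    using exists_large_dilate_sum_quotient[OF p K] by blast
  define D where "D = (\<lambda>(a, b). (a - b) mod p) ` (iter_sumset p K 3 \<times> iter_sumset p K 3)"
  define Z where "Z = (\<lambda>(a, x). (a + z * x) mod p) ` (K \<times> K)"
  have ZI: "Z \<subseteq> {0..<p}" using p0 by (auto simp: Z_def)
  have three: "(k + l + m) mod p \<in> iter_sumset p K 3" if "k \<in> K" "l \<in> K" "m \<in> K" for k l m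
  proof -
    have "(k + (l + (m + 0) mod p) mod p) mod p \<in> iter_sumset p K (Suc (Suc (Suc 0)))"
      using that by (intro iter_sumset_SucI) auto
    then show ?thesis by (simp add: numeral_3_eq_3 mod_simps add.assoc)
  qed
  have "inj_on (\<lambda>x. ((c - d) * x) mod p) Z"
  proof (intro inj_onI)
    fix x y assume xy: "x \<in> Z" "y \<in> Z" "((c - d) * x) mod p = ((c - d) * y) mod p"
    then have "p dvd (c - d) * (x - y)" by (simp add: mod_eq_dvd_iff algebra_simps)
    then have "p dvd c - d \<or> p dvd x - y" using p by (simp add: prime_dvd_mult_iff)
    moreover have "\<not> p dvd c - d" using mem K cong_imp_eq_residue by blast
    ultimately show "x = y" using xy ZI by (intro cong_imp_eq_residue) auto
  qed
  moreover have "(\<lambda>x. ((c - d) * x) mod p) ` Z \<subseteq> D"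
  proof safe
    fix w assume "w \<in> Z"
    then obtain k x where kx: "k \<in> K" "x \<in> K" "w = (k + z * x) mod p" by (auto simp: Z_def)
    define u where "u = ((c * k) mod p + (a * x) mod p + (a' * x) mod p) mod p"
    define v where "v = ((d * k) mod p + (b * x) mod p + (b' * x) mod p) mod p"
    have "u \<in> iter_sumset p K 3" "v \<in> iter_sumset p K 3"
      unfolding u_def v_def by (intro three mult mem kx)+
    then have "(u - v) mod p \<in> D" by (auto simp: D_def)
    also have "(u - v) mod p = ((c - d) * w) mod p"
    proof -
      have "u mod p = (c * k + a * x + a' * x) mod p" "v mod p = (d * k + b * x + b' * x) mod p"
        unfolding u_def v_def mod_mod_trivial by (intro mod_add_cong mod_mod_trivial)+
      then have 1: "(u - v) mod p = (c * k + a * x + a' * x - (d * k + b * x + b' * x)) mod p"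
        by (rule mod_diff_cong)
      have 2: "((c - d) * w) mod p = ((c - d) * (k + z * x)) mod p"
        by (simp add: kx mod_simps)
      have "p dvd x * ((c - d) * z - (a + a' - b - b'))" using dvd by simp
      moreover have "(c - d) * (k + z * x) - (c * k + a * x + a' * x - (d * k + b * x + b' * x))
         = x * ((c - d) * z - (a + a' - b - b'))" by (simp add: algebra_simps)
      ultimately have "p dvd (c - d) * (k + z * x) - (c * k + a * x + a' * x - (d * k + b * x + b' * x))"
        by simp
      then have "((c - d) * (k + z * x)) mod p = (c * k + a * x + a' * x - (d * k + b * x + b' * x)) mod p"
        by (simp only: mod_eq_dvd_iff)
      with 1 2 show ?thesis by simp
    qed
    finally show "((c - d) * w) mod p \<in> D" .
  qed
  moreover have "finite D" using p0 by (simp add: D_def finite_iter_sumset)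
  ultimately have "card Z \<le> card D" by (meson card_inj_on_le)
  then show ?thesis using card by (simp add: Z_def D_def)
qed

text \<open>Translate a fixed representation \<open>d = f1 - f2\<close> by \<open>w \<in> A\<close>:
  the pair \<open>(f1 + w, f2 + w)\<close> lies in the square of \<open>A + A\<close> and determines
  first \<open>d\<close>, then \<open>w\<close>. This trades differences for sums, the only form
  that yields sums of powers of 2.\<close>

lemma ruzsa_triangle:
  fixes p :: int
  assumes A: "A \<subseteq> {0..<p}" and p: "p > 0"
  shows "card A * card ((\<lambda>(a, b). (a - b) mod p) ` (A \<times> A)) \<le> (card (sumset_mod p A A))\<^sup>2"
proof -
  define D where "D = (\<lambda>(a, b). (a - b) mod p) ` (A \<times> A)"
  have fin: "finite A" using A finite_subset by blast
  have "\<forall>d\<in>D. \<exists>s. s \<in> A \<times> A \<and> d = (fst s - snd s) mod p" by (force simp: D_def)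
  then obtain f where f: "\<And>d. d \<in> D \<Longrightarrow> f d \<in> A \<times> A" "\<And>d. d \<in> D \<Longrightarrow> d = (fst (f d) - snd (f d)) mod p"
    by metis
  define F where "F = (\<lambda>(w, d). ((fst (f d) + w) mod p, (snd (f d) + w) mod p))"
  have "inj_on F (A \<times> D)"
  proof (intro inj_onI)
    fix s s' assume s: "s \<in> A \<times> D" "s' \<in> A \<times> D" and eq: "F s = F s'"
    obtain w d w' d' where ss: "s = (w, d)" "s' = (w', d')" by (cases s, cases s')
    from eq have e: "(fst (f d) + w) mod p = (fst (f d') + w') mod p"
       "(snd (f d) + w) mod p = (snd (f d') + w') mod p" by (simp_all add: F_def ss)
    have "((fst (f d) + w) - (snd (f d) + w)) mod p = ((fst (f d') + w') - (snd (f d') + w')) mod p"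
      using e by (rule mod_diff_cong)
    then have "d = d'" using f(2)[of d] f(2)[of d'] s ss by simp
    moreover from this e(1) have "p dvd w - w'" by (simp add: mod_eq_dvd_iff)
    then have "w = w'" using s A ss by (intro cong_imp_eq_residue) auto
    ultimately show "s = s'" by (simp add: ss)
  qed
  moreover have "F ` (A \<times> D) \<subseteq> sumset_mod p A A \<times> sumset_mod p A A"
  proof safe
    fix w d x y assume "w \<in> A" "d \<in> D" "(x, y) = F (w, d)"
    then show "x \<in> sumset_mod p A A" "y \<in> sumset_mod p A A"
      using f(1)[of d] by (cases "f d"; auto simp: F_def sumset_mod_def)+
  qed
  ultimately have "card (A \<times> D) \<le> card (sumset_mod p A A \<times> sumset_mod p A A)"
    using fin by (intro card_inj_on_le[of F]) (auto simp: sumset_mod_def)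
  then show ?thesis by (simp add: card_cartesian_product D_def power2_eq_square)
qed

section \<open>Growth up to half of all residues\<close>

lemma card_sumset_mod_ge:
  fixes p :: int
  assumes "A \<subseteq> {0..<p}" "B \<noteq> {}" "finite B"
  shows "card A \<le> card (sumset_mod p A B)"
proof -
  obtain b where b: "b \<in> B" using assms by blast
  have "inj_on (\<lambda>a. (a + b) mod p) A"
    using assms(1) by (auto simp: inj_on_def mod_eq_dvd_iff intro!: cong_imp_eq_residue)
  moreover have "(\<lambda>a. (a + b) mod p) ` A \<subseteq> sumset_mod p A B"
    using b by (auto simp: sumset_mod_def)
  moreover have "finite (sumset_mod p A B)"
    using assms finite_subset[OF assms(1)] by (simp add: sumset_mod_def)
  ultimately show ?thesis by (rule card_inj_on_le)
qed

text \<open>As \<open>p\<close> is odd, half means more than half, so \<open>A\<close> and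
  \<open>-A\<close> intersect by pigeonhole.\<close>

lemma zero_mem_sumset_of_half:
  fixes p :: int
  assumes A: "A \<subseteq> {0..<p}" and p: "odd p" "p > 0" and half: "2 * card A \<ge> p"
  shows "0 \<in> sumset_mod p A A"
proof -
  define B where "B = (\<lambda>a. (- a) mod p) ` A"
  have fin: "finite A" using A by (rule finite_subset) auto
  have "inj_on (\<lambda>a. (- a) mod p) A"
  proof (intro inj_onI)
    fix x y assume xy: "x \<in> A" "y \<in> A" "(- x) mod p = (- y) mod p"
    then have "p dvd - x - - y" by (simp only: mod_eq_dvd_iff)
    then have "p dvd y - x" by (simp add: algebra_simps)
    then show "x = y" using xy A by (intro cong_imp_eq_residue[symmetric]) auto
  qed
  then have "card B = card A" by (simp add: B_def card_image)
  have "A \<inter> B \<noteq> {}"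
  proof
    assume "A \<inter> B = {}"
    then have "card A + card B = card (A \<union> B)"
      using fin by (intro card_Un_disjoint[symmetric]) (auto simp: B_def)
    also have "\<dots> \<le> card {0..<p}" using A p by (intro card_mono) (auto simp: B_def)
    finally have "2 * int (card A) \<le> p" using \<open>card B = card A\<close> p by simp
    with half have "p = 2 * int (card A)" by simp
    then show False using p(1) by simp
  qed
  then obtain a b where ab: "a \<in> A" "b \<in> A" "a = (- b) mod p" by (auto simp: B_def)
  then have "(a + b) mod p = 0" by (simp add: mod_add_left_eq)
  then show ?thesis using ab(1,2) by (force simp: sumset_mod_def)
qed

text \<open>Source of the threshold \<open>4 ^ 100\<close>: the hundredth root of \<open>p\<close>
  absorbs the constant factors lost in the estimates below.\<close>

lemma powr_hundredth_ge_4: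
  fixes p :: int
  assumes "p \<ge> 4 ^ 100" shows "real_of_int p powr 0.01 \<ge> 4"
proof -
  have "real_of_int (4 ^ 100) \<le> real_of_int p" using assms by (rule of_int_le_iff[THEN iffD2])
  then have "(4::real) ^ 100 \<le> real_of_int p" by (simp only: of_int_power of_int_numeral)
  moreover have "(4::real) ^ 100 = 4 powr 100" by (rule powr_numeral[symmetric]) simp
  ultimately have "(4 powr 100) powr (0.01::real) \<le> real_of_int p powr 0.01"
    by (intro powr_mono2) simp_all
  then show ?thesis by (simp add: powr_powr)
qed

text \<open>Ruzsa's inequality with \<open>|3K| \<ge> p^0.44\<close> and
  \<open>|3K - 3K| \<ge> p^0.88 / 2\<close> gives
  \<open>|6K|^2 \<ge> p^1.32 / 2 \<ge> p^1.31\<close>, and 0.655 is half of 1.31.\<close>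

lemma card_six_fold_ge:
  fixes p :: int
  assumes p: "prime p" "p \<ge> 4 ^ 100" and K: "K \<subseteq> {0..<p}" "real (card K) \<ge> p powr 0.44"
    and mult: "\<And>k l. k \<in> K \<Longrightarrow> l \<in> K \<Longrightarrow> (k * l) mod p \<in> K"
  shows "real (card (iter_sumset p K 6)) \<ge> p powr 0.655"
proof -
  define P where "P = real_of_int p"
  define h where "h = real (card K)"
  have p0: "p > 0" using p by (simp add: prime_gt_0_int)
  have P1: "P \<ge> 1" using p0 by (simp add: P_def)
  have four: "P powr 0.01 \<ge> 4" unfolding P_def using p(2) by (rule powr_hundredth_ge_4)
  have h: "h \<ge> P powr 0.44" using K by (simp add: h_def P_def)
  have "P powr 0.01 \<le> P powr 0.44" using P1 by (intro powr_mono) auto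
  with h four have "h \<ge> 2" by linarith
  then have K2: "card K \<ge> 2" by (simp add: h_def)
  then have Kne: "K \<noteq> {}" by auto
  define D where "D = real (card ((\<lambda>(a, b). (a - b) mod p) ` (iter_sumset p K 3 \<times> iter_sumset p K 3)))"
  have "P powr 0.88 \<le> P" using P1 powr_mono[of "0.88" 1 P] by simp
  moreover have "P powr 0.88 \<le> h\<^sup>2"
  proof -
    have "(P powr 0.44)\<^sup>2 \<le> h\<^sup>2" using h by (intro power_mono) auto
    moreover have "(P powr 0.44)\<^sup>2 = P powr 0.88"
      by (simp add: power2_eq_square powr_add [symmetric])
    ultimately show ?thesis by simp
  qed
  moreover have "D \<ge> min P (h\<^sup>2) / 2"
    using card_diffset_three_fold_ge[OF p(1) K(1) K2 mult] by (simp add: D_def P_def h_def)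
  ultimately have D: "D \<ge> P powr 0.88 / 2" by linarith
  define T where "T = real (card (iter_sumset p K 3))"
  define X where "X = real (card (iter_sumset p K 6))"
  have "card K \<le> card (iter_sumset p K (Suc 2))"
    unfolding iter_sumset.simps
    by (intro card_sumset_mod_ge K iter_sumset_nonempty Kne finite_iter_sumset p0)
  then have "T \<ge> P powr 0.44" using h by (simp add: T_def h_def numeral_3_eq_3 numeral_2_eq_2)
  have "real (card (iter_sumset p K 3) * card ((\<lambda>(a, b). (a - b) mod p) ` (iter_sumset p K 3 \<times> iter_sumset p K 3)))
      \<le> real ((card (sumset_mod p (iter_sumset p K 3) (iter_sumset p K 3)))\<^sup>2)"
    using ruzsa_triangle[OF iter_sumset_subset[OF p0] p0] of_nat_le_iff by blast
  then have "T * D \<le> (real (card (sumset_mod p (iter_sumset p K 3) (iter_sumset p K 3))))\<^sup>2"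
    by (simp add: T_def D_def)
  also have "\<dots> \<le> X\<^sup>2"
    using card_mono[OF finite_iter_sumset[OF p0] sumset_mod_iter_sumset_subset[OF p0, of K 3 3]]
    by (intro power_mono) (simp_all add: X_def)
  finally have "T * D \<le> X\<^sup>2" .
  moreover have "P powr 0.44 * (P powr 0.88 / 2) \<le> T * D"
    using \<open>T \<ge> P powr 0.44\<close> D by (intro mult_mono) (auto simp: T_def)
  moreover have "(P powr 0.655)\<^sup>2 \<le> P powr 0.44 * (P powr 0.88 / 2)"
  proof -
    have "(P powr 0.655)\<^sup>2 = P powr 1.31"
      by (simp add: power2_eq_square powr_add [symmetric])
    moreover have "P powr 0.44 * P powr 0.88 = P powr 1.31 * P powr 0.01"
      by (simp add: powr_add [symmetric])
    moreover have "P powr 1.31 * 4 \<le> P powr 1.31 * P powr 0.01"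
      using four by (intro mult_left_mono) auto
    ultimately show ?thesis using powr_ge_zero[of P "1.31"] by linarith
  qed
  ultimately have "(P powr 0.655)\<^sup>2 \<le> X\<^sup>2" by (meson order_trans)
  then have "P powr 0.655 \<le> X" by (rule power2_le_imp_le) (simp add: X_def)
  then show ?thesis by (simp add: X_def P_def)
qed

lemma zero_mem_iter_sumset:
  fixes p :: int
  assumes p: "prime p" "p \<ge> 4 ^ 100" and K: "K \<subseteq> {0..<p}" "real (card K) \<ge> p powr 0.44"
    and mult: "\<And>k l. k \<in> K \<Longrightarrow> l \<in> K \<Longrightarrow> (k * l) mod p \<in> K"
  shows "0 \<in> iter_sumset p K 72"
proof -
  define P where "P = real_of_int p"
  define h where "h = real (card K)"
  define X where "X = real (card (iter_sumset p K 6))"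
  have p0: "p > 0" using p by (simp add: prime_gt_0_int)
  have P1: "P \<ge> 1" using p0 by (simp add: P_def)
  have four: "P powr 0.01 \<ge> 4" unfolding P_def using p(2) by (rule powr_hundredth_ge_4)
  have h: "h \<ge> P powr 0.44" using K by (simp add: h_def P_def)
  moreover have "P powr 0.44 > 0" using P1 by simp
  ultimately have "h > 0" by linarith
  then have "card K \<noteq> 0" by (simp add: h_def)
  then have Kne: "K \<noteq> {}" by auto
  have X: "X \<ge> P powr 0.655" using card_six_fold_ge[OF p K mult] by (simp add: X_def P_def)
  \<comment> \<open>The gain per added copy of \<open>6K\<close>: the exponent is
    \<open>0.655 + 0.44 - 1 = 0.095\<close>, of which 0.01 pays for the factor 2 and the rest is
    rounded down to 0.08.\<close>
  have ratio: "P powr 0.08 \<le> X * h / P / 2"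
  proof -
    have "P powr 0.655 * P powr 0.44 \<le> X * h" using X h by (intro mult_mono) (auto simp: X_def)
    moreover have "P powr 0.655 * P powr 0.44 = P powr 0.085 * P powr 0.01 * P"
      using P1 by (simp add: powr_add [symmetric] powr_mult_base mult.commute)
    ultimately have "P powr 0.085 * P powr 0.01 \<le> X * h / P" using P1 by (simp add: field_simps)
    moreover have "P powr 0.085 * 4 \<le> P powr 0.085 * P powr 0.01"
      using four by (intro mult_left_mono) auto
    moreover have "P powr 0.08 \<le> P powr 0.085" using P1 by (intro powr_mono) auto
    moreover have "d \<le> c / 2" if "a * b \<le> c" "a * 4 \<le> a * b" "d \<le> a" "0 \<le> a" for a b c d :: real
      using that by linarith
    ultimately show ?thesis using powr_ge_zero by blast
  qed
  have growth: "real (card (iter_sumset p K (6 * Suc j))) \<ge> min (P / 2) (P powr (0.65 + 0.08 * j))" for j :: nat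
  proof (induction j)
    case 0
    have "P powr 0.65 \<le> P powr 0.655" using P1 by (intro powr_mono) auto
    then show ?case using X by (simp add: X_def)
  next
    case (Suc j)
    define A where "A = real (card (iter_sumset p K (6 * Suc j)))"
    have "real (card (sumset_mod p (iter_sumset p K (6 * Suc j)) (iter_sumset p K 6)))
        \<ge> min P (A * X * h / P) / 2"
      using card_sumset_mod_invariant_ge[OF p(1) iter_sumset_subset[OF p0] iter_sumset_nonempty[OF Kne]
          iter_sumset_subset[OF p0] iter_sumset_nonempty[OF Kne] K(1) iter_sumset_mult[OF mult],
          of 6 "6 * Suc j"]
      by (simp add: P_def A_def X_def h_def)
    also have "card (sumset_mod p (iter_sumset p K (6 * Suc j)) (iter_sumset p K 6)) \<le> card (iter_sumset p K (6 * Suc (Suc j)))"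
      using card_mono[OF finite_iter_sumset[OF p0] sumset_mod_iter_sumset_subset[OF p0, of K "6 * Suc j" 6]]
      by (simp add: algebra_simps)
    finally have B: "real (card (iter_sumset p K (6 * Suc (Suc j)))) \<ge> min P (A * X * h / P) / 2"
      by simp
    have "A * (P powr 0.08) \<le> A * (X * h / P / 2)"
      using ratio by (intro mult_left_mono) (auto simp: A_def)
    then have B': "real (card (iter_sumset p K (6 * Suc (Suc j)))) \<ge> min (P / 2) (A * (P powr 0.08))"
      using B by (simp add: min_def split: if_splits)
    have IH: "A \<ge> min (P / 2) (P powr (0.65 + 0.08 * j))" using Suc by (simp add: A_def)
    have P08: "1 \<le> P powr 0.08" using P1 by (simp add: ge_one_powr_ge_zero)
    show ?case
    proof (cases "A \<ge> P / 2")
      case True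
      then have "A * P powr 0.08 \<ge> P / 2"
        using P08 P1 mult_mono[of "P / 2" A 1 "P powr 0.08"] by (simp add: A_def)
      with B' show ?thesis by linarith
    next
      case False
      with IH have "P powr (0.65 + 0.08 * j) \<le> A" by linarith
      then have "P powr (0.65 + 0.08 * j) * P powr 0.08 \<le> A * P powr 0.08"
        by (intro mult_right_mono) auto
      also have "P powr (0.65 + 0.08 * j) * P powr 0.08 = P powr (0.65 + 0.08 * Suc j)"
      proof -
        have "0.65 + 0.08 * real (Suc j) = (0.65 + 0.08 * real j) + 0.08" by (simp add: field_simps)
        then show ?thesis by (simp only: powr_add)
      qed
      finally show ?thesis using B' by linarith
    qed
  qed
  \<comment> \<open>After five further copies of \<open>6K\<close> the exponent is
    \<open>0.65 + 5 * 0.08 = 1.05\<close>, beyond 1, so the minimum is \<open>P / 2\<close> and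
    \<open>36K\<close> holds at least half of the residues. Then
    \<open>72 = 36 + 36\<close>.\<close>
  have "P powr 1 \<le> P powr 1.05" using P1 by (intro powr_mono) auto
  then have "P / 2 \<le> real (card (iter_sumset p K 36))"
    using growth[of 5] P1 by (simp add: min_def split: if_splits)
  then have "P \<le> real_of_int (2 * int (card (iter_sumset p K 36)))" by simp
  then have "p \<le> 2 * int (card (iter_sumset p K 36))"
    unfolding P_def by (simp only: of_int_le_iff)
  moreover have "odd p"
  proof -
    have "(2::int) < 4 ^ 100" by simp
    then have "2 < p" using p(2) by linarith
    then show ?thesis using p(1) by (rule prime_odd_int[rotated])
  qed
  ultimately have "0 \<in> sumset_mod p (iter_sumset p K 36) (iter_sumset p K 36)"
    by (intro zero_mem_sumset_of_half iter_sumset_subset p0) auto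
  then show ?thesis using sumset_mod_iter_sumset_subset[OF p0, of K 36 36] by auto
qed

section \<open>Counting exceptional integers\<close>

lemma prod_primes_dvd_of_dvd:
  fixes P :: "nat set"
  assumes "finite P" "\<And>p. p \<in> P \<Longrightarrow> prime p" "\<And>p. p \<in> P \<Longrightarrow> p dvd m"
  shows "\<Prod>P dvd m"
  using assms
proof (induction P rule: finite_induct)
  case (insert p P)
  have "coprime p (\<Prod>q\<in>P. q)"
    using insert.hyps insert.prems by (intro prod_coprime_right primes_coprime) auto
  then show ?case using insert by (simp add: divides_mult)
qed simp

lemma card_multiples_le:
  fixes d N :: nat
  assumes "d > 0" shows "real (card {n \<in> {1..N}. d dvd n}) \<le> N / d"
proof -
  have "{n \<in> {1..N}. d dvd n} \<subseteq> (\<lambda>k. d * k) ` {1..N div d}"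
  proof
    fix n assume n: "n \<in> {n \<in> {1..N}. d dvd n}"
    then obtain k where "n = d * k" by blast
    with n assms have "n = d * k" "k \<in> {1..N div d}"
      by (auto simp: less_eq_div_iff_mult_less_eq mult.commute Suc_le_eq)
    then show "n \<in> (\<lambda>k. d * k) ` {1..N div d}" by blast
  qed
  then have "card {n \<in> {1..N}. d dvd n} \<le> card ((\<lambda>k. d * k) ` {1..N div d})"
    by (intro card_mono) auto
  also have "\<dots> \<le> card {1..N div d}" by (rule card_image_le) simp
  finally have "card {n \<in> {1..N}. d dvd n} \<le> N div d" by simp
  then have "real (card {n \<in> {1..N}. d dvd n}) \<le> real (N div d)" by (simp only: of_nat_le_iff)
  also have "\<dots> \<le> N / d" by (rule of_nat_div_le_of_nat)
  finally show ?thesis .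
qed

lemma card_multiples_Union_le:
  fixes f :: "'a \<Rightarrow> nat" and N :: nat
  assumes "finite I" "\<And>i. i \<in> I \<Longrightarrow> f i > 0"
  shows "real (card {n \<in> {1..N}. \<exists>i\<in>I. f i dvd n}) \<le> N * (\<Sum>i\<in>I. 1 / f i)"
proof -
  have "{n \<in> {1..N}. \<exists>i\<in>I. f i dvd n} = (\<Union>i\<in>I. {n \<in> {1..N}. f i dvd n})" by auto
  then have "card {n \<in> {1..N}. \<exists>i\<in>I. f i dvd n} \<le> (\<Sum>i\<in>I. card {n \<in> {1..N}. f i dvd n})"
    by (simp only: card_UN_le[OF assms(1)])
  then have "real (card {n \<in> {1..N}. \<exists>i\<in>I. f i dvd n}) \<le> real (\<Sum>i\<in>I. card {n \<in> {1..N}. f i dvd n})"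
    by (simp only: of_nat_le_iff)
  also have "\<dots> = (\<Sum>i\<in>I. real (card {n \<in> {1..N}. f i dvd n}))" by (rule of_nat_sum)
  also have "\<dots> \<le> (\<Sum>i\<in>I. N / f i)" by (intro sum_mono card_multiples_le assms)
  finally show ?thesis by (simp add: sum_distrib_left)
qed

lemma sum_inverse_le:
  fixes N :: nat
  assumes "N \<ge> 1" shows "(\<Sum>i=1..N. 1 / real i) \<le> 1 + ln N"
  using assms
proof (induction N rule: dec_induct)
  case (step n)
  have "1 / real (Suc n) \<le> ln (Suc n) - ln n"
  proof -
    have "ln (real n / real (Suc n)) \<le> real n / real (Suc n) - 1"
      using step by (intro ln_le_minus_one) simp
    moreover have "ln (real n / real (Suc n)) = ln n - ln (Suc n)"
      by (rule ln_divide_pos) (use step in auto)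
    moreover have "real n / real (Suc n) - 1 = - (1 / real (Suc n))" by (simp add: field_simps)
    ultimately show ?thesis by linarith
  qed
  then show ?case using step by simp
qed simp

lemma sum_inverse_squares_le:
  fixes Y :: real and N :: nat
  assumes "Y > 0" shows "(\<Sum>d | d \<in> {1..N} \<and> Y \<le> real d. 1 / (real d)\<^sup>2) \<le> 2 / Y"
proof -
  define a where "a = nat \<lceil>Y\<rceil>"
  have a: "a \<ge> 1" "Y \<le> a" using assms by (auto simp: a_def Suc_le_eq)
  \<comment> \<open>Telescoping with \<open>1/(b+1)^2 \<le> 1/b - 1/(b+1)\<close>; the 2 leaves room
    for the first term \<open>1/a^2 \<le> 1/a\<close>.\<close>
  have tel: "(\<Sum>d=a..b. 1 / (real d)\<^sup>2) \<le> 2 / a - 1 / b" if "b \<ge> a" for b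
    using that
  proof (induction b rule: dec_induct)
    case base
    have "1 / (real a)\<^sup>2 \<le> 1 / real a"
      using a by (simp add: power2_eq_square field_simps)
    then show ?case by simp
  next
    case (step b)
    have "1 / (real (Suc b))\<^sup>2 \<le> 1 / b - 1 / Suc b"
    proof -
      have "b > 0" using step a by simp
      then have "1 / real b - 1 / real (Suc b) = 1 / (real b * real (Suc b))"
        by (simp add: field_simps)
      moreover have "1 / (real (Suc b))\<^sup>2 \<le> 1 / (real b * real (Suc b))"
        using \<open>b > 0\<close> by (intro divide_left_mono) (auto simp: power2_eq_square)
      ultimately show ?thesis by simp
    qed
    then show ?case using step by simp
  qed
  have "(\<Sum>d | d \<in> {1..N} \<and> Y \<le> real d. 1 / (real d)\<^sup>2) \<le> (\<Sum>d=a..max a N. 1 / (real d)\<^sup>2)"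
    by (intro sum_mono2) (auto simp: a_def nat_le_iff ceiling_le_iff)
  also have "\<dots> \<le> 2 / a - 1 / max a N" by (rule tel) simp
  also have "\<dots> \<le> 2 / a" by simp
  also have "\<dots> \<le> 2 / Y" using a assms by (intro divide_left_mono) auto
  finally show ?thesis .
qed

section \<open>Large square divisors and many prime factors\<close>

lemma card_large_square_divisor_le:
  fixes Y :: real and N :: nat
  assumes "Y > 0"
  shows "real (card {n \<in> {1..N}. \<exists>d. Y \<le> real d \<and> d\<^sup>2 dvd n}) \<le> N * (2 / Y)"
proof -
  define I where "I = {d. d \<in> {1..N} \<and> Y \<le> real d}"
  have "{n \<in> {1..N}. \<exists>d. Y \<le> real d \<and> d\<^sup>2 dvd n} \<subseteq> {n \<in> {1..N}. \<exists>d\<in>I. d\<^sup>2 dvd n}"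
  proof safe
    fix n d assume n: "n \<in> {1..N}" and d: "Y \<le> real d" "d\<^sup>2 dvd n"
    have "d \<ge> 1" using d assms by (cases d) auto
    moreover have "d \<le> d\<^sup>2" using \<open>d \<ge> 1\<close> by (simp add: power2_eq_square)
    moreover have "d\<^sup>2 \<le> n" using d n by (intro dvd_imp_le) auto
    ultimately show "\<exists>d\<in>I. d\<^sup>2 dvd n" using d n by (intro bexI[of _ d]) (auto simp: I_def)
  qed
  then have "real (card {n \<in> {1..N}. \<exists>d. Y \<le> real d \<and> d\<^sup>2 dvd n}) \<le> real (card {n \<in> {1..N}. \<exists>d\<in>I. d\<^sup>2 dvd n})"
    by (intro of_nat_mono card_mono) auto
  also have "\<dots> \<le> N * (\<Sum>d\<in>I. 1 / real (d\<^sup>2))"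
    by (intro card_multiples_Union_le) (auto simp: I_def)
  also have "\<dots> \<le> N * (2 / Y)"
    using sum_inverse_squares_le[OF assms, of N] by (intro mult_left_mono) (auto simp: I_def)
  finally show ?thesis .
qed

text \<open>Each set of prime factors is recovered from its product as the set of its prime
  divisors, so distinct subsets give distinct divisors of \<open>n\<close>.\<close>

lemma two_power_card_prime_factors_le:
  fixes n :: nat
  assumes "n > 0" shows "2 ^ card (prime_factors n) \<le> card {d. d dvd n}"
proof -
  have "inj_on (\<lambda>S. \<Prod>S) (Pow (prime_factors n))"
  proof (rule inj_onI)
    fix S T assume S: "S \<in> Pow (prime_factors n)" and T: "T \<in> Pow (prime_factors n)" and eq: "\<Prod>S = \<Prod>T"
    have pf: "A = {p. prime p \<and> p dvd \<Prod>A}" if "A \<subseteq> prime_factors n" for A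
    proof -
      have fin: "finite A" using that finite_subset by blast
      have "p \<in> A" if "prime p" "p dvd \<Prod>A" for p
      proof -
        obtain a where "a \<in> A" "p dvd a"
          using \<open>prime p\<close> \<open>p dvd \<Prod>A\<close> fin by (auto simp: prime_dvd_prod_iff)
        then show ?thesis using \<open>prime p\<close> \<open>A \<subseteq> _\<close> by (metis in_prime_factors_iff primes_dvd_imp_eq subsetD)
      qed
      moreover have "prime p \<and> p dvd \<Prod>A" if "p \<in> A" for p
        using that \<open>A \<subseteq> _\<close> fin by (auto intro!: dvd_prodI[of A p "\<lambda>x. x"])
      ultimately show ?thesis by blast
    qed
    show "S = T" using pf[of S] pf[of T] S T eq by auto
  qed
  moreover have "(\<lambda>S. \<Prod>S) ` Pow (prime_factors n) \<subseteq> {d. d dvd n}"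
  proof safe
    fix S assume S: "S \<subseteq> prime_factors n"
    have "\<Prod>S dvd \<Prod>(prime_factors n)"
      using S by (intro prod_dvd_prod_subset) auto
    also have "\<dots> dvd (\<Prod>p\<in>prime_factors n. p ^ multiplicity p n)"
      by (intro prod_dvd_prod dvd_power) (auto simp: prime_factors_multiplicity)
    also have "\<dots> = n" using prime_factorization_nat[of n] assms by simp
    finally show "\<Prod>S dvd n" .
  qed
  moreover have "finite {d. d dvd n}" using assms by simp
  ultimately have "card (Pow (prime_factors n)) \<le> card {d. d dvd n}" by (rule card_inj_on_le)
  then show ?thesis by (simp add: card_Pow)
qed

text \<open>Exchange the order of summation: each \<open>d\<close> has at most \<open>N / d\<close>
  multiples up to \<open>N\<close>, and a harmonic sum remains.\<close>

lemma sum_card_divisors_le: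
  fixes N :: nat
  assumes "N \<ge> 1" shows "(\<Sum>n=1..N. real (card {d. d dvd n})) \<le> N * (1 + ln N)"
proof -
  have "(\<Sum>n=1..N. real (card {d. d dvd n})) = (\<Sum>n=1..N. \<Sum>d=1..N. if d dvd n then 1 else 0)"
  proof (intro sum.cong refl)
    fix n assume n: "n \<in> {1..N}"
    have "d \<in> {1..N}" if "d dvd n" for d
      using n dvd_imp_le[OF that] dvd_pos_nat[OF _ that] by auto
    then have "{d. d dvd n} = {1..N} \<inter> {d. d dvd n}" by blast
    then show "real (card {d. d dvd n}) = (\<Sum>d=1..N. if d dvd n then 1 else 0)"
      by (simp add: sum.If_cases)
  qed
  also have "\<dots> = (\<Sum>d=1..N. \<Sum>n=1..N. if d dvd n then 1 else 0)" by (rule sum.swap)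
  also have "\<dots> = (\<Sum>d=1..N. real (card {n \<in> {1..N}. d dvd n}))"
    by (simp add: sum.If_cases Int_def)
  also have "\<dots> \<le> (\<Sum>d=1..N. N * (1 / real d))"
    by (intro sum_mono) (use card_multiples_le in auto)
  also have "\<dots> = N * (\<Sum>d=1..N. 1 / real d)" by (simp only: sum_distrib_left)
  also have "\<dots> \<le> N * (1 + ln N)" using sum_inverse_le[OF assms] by (intro mult_left_mono) auto
  finally show ?thesis .
qed

text \<open>Markov's inequality for the divisor function, which dominates
  \<open>2 ^ card (prime_factors n)\<close>.\<close>

lemma card_many_prime_factors_le:
  fixes T :: real and N :: nat
  assumes "N \<ge> 1" "T > 0"
  shows "real (card {n \<in> {1..N}. T \<le> 2 ^ card (prime_factors n)}) \<le> N * (1 + ln N) / T"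
proof -
  define A where "A = {n \<in> {1..N}. T \<le> 2 ^ card (prime_factors n)}"
  have "real (card A) * T = (\<Sum>n\<in>A. T)" by simp
  also have "\<dots> \<le> (\<Sum>n\<in>A. real (card {d. d dvd n}))"
  proof (rule sum_mono)
    fix n assume n: "n \<in> A"
    then have "T \<le> real (2 ^ card (prime_factors n))" by (simp add: A_def)
    also have "\<dots> \<le> real (card {d. d dvd n})"
      using n by (intro of_nat_mono two_power_card_prime_factors_le) (auto simp: A_def)
    finally show "T \<le> real (card {d. d dvd n})" .
  qed
  also have "\<dots> \<le> (\<Sum>n=1..N. real (card {d. d dvd n}))"
    by (intro sum_mono2) (auto simp: A_def)
  also have "\<dots> \<le> N * (1 + ln N)" by (rule sum_card_divisors_le) fact
  finally show ?thesis using assms by (simp add: A_def field_simps)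
qed

section \<open>Small orders of 2 and large common divisors\<close>

lemma card_primes_ord_eq_le:
  fixes A :: "nat set"
  assumes "finite A" "m > 0" "\<And>p. p \<in> A \<Longrightarrow> prime p \<and> ord p 2 = m"
  shows "card A \<le> m"
proof -
  \<comment> \<open>Each member of \<open>A\<close> divides \<open>2 ^ m - 1\<close>, hence so does
    the product, which is at least \<open>2 ^ card A\<close>.\<close>
  have "\<Prod>A dvd 2 ^ m - 1"
  proof -
    have "p dvd 2 ^ m - 1" if "p \<in> A" for p
      using cong_to_1_nat[OF ord[of 2 p]] assms(3)[OF that] by simp
    then show ?thesis using assms by (intro prod_primes_dvd_of_dvd) auto
  qed
  then have "\<Prod>A \<le> 2 ^ m - 1" using one_less_power[of "2::nat" m] assms(2) by (intro dvd_imp_le) auto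
  moreover have "(2::nat) ^ card A \<le> \<Prod>A"
    using prod_mono[of A "\<lambda>_. 2" "\<lambda>p. p"] assms(3) prime_ge_2_nat by simp
  moreover have "(2::nat) ^ m - 1 < 2 ^ m" by simp
  ultimately have "(2::nat) ^ card A < 2 ^ m" by linarith
  then show ?thesis by simp
qed

text \<open>Grouping the primes by their order \<open>m\<close> makes the sum of reciprocals at most
  \<open>\<Sum>m. m / m\<^sup>2\<close>, because at most \<open>m\<close> primes divide \<open>2 ^ m - 1\<close>.\<close>

lemma card_prime_divisor_small_order_le:
  fixes Y :: real and N :: nat
  assumes "N \<ge> 1" "Y \<ge> 2"
  shows "real (card {n \<in> {1..N}. \<exists>p. prime p \<and> Y < real p \<and> p dvd n \<and> real (ord p 2) < p powr 0.45})
    \<le> N * (Y powr - 0.1 * (1 + ln N))"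
proof -
  define I where "I = {p \<in> {1..N}. prime p \<and> Y < real p \<and> real (ord p 2) < p powr 0.45}"
  have finI: "finite I" by (simp add: I_def)
  have ord: "ord p 2 \<in> {1..N}" "1 / real p \<le> Y powr -0.1 * (1 / (ord p 2)\<^sup>2)" if "p \<in> I" for p
  proof -
    have p: "prime p" "Y < real p" "real (ord p 2) < p powr 0.45" "p \<le> N" using that by (auto simp: I_def)
    \<comment> \<open>\<open>ord p 2\<close> takes the value 0 unless \<open>p\<close> and 2 are
      coprime, so \<open>p = 2\<close> has to be excluded.\<close>
    then have "p \<noteq> 2" using assms by auto
    then have "coprime p 2" using p(1) primes_coprime two_is_prime_nat by blast
    then have pos: "ord p 2 > 0" by simp
    have p1: "real p \<ge> 1" using p(1) prime_ge_1_nat by (metis of_nat_1 of_nat_mono)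
    have "p powr 0.45 \<le> p powr 1" using p1 by (intro powr_mono) auto
    then have "real (ord p 2) < real p" using p by simp
    then show "ord p 2 \<in> {1..N}" using pos \<open>p \<le> N\<close> unfolding atLeastAtMost_iff by linarith
    have "(real (ord p 2))\<^sup>2 \<le> (p powr 0.45)\<^sup>2" using p by (intro power_mono) auto
    also have "\<dots> = p powr 0.9" by (simp add: power2_eq_square powr_add [symmetric])
    finally have 1: "p powr - 0.9 \<le> 1 / (real (ord p 2))\<^sup>2"
      using pos p1 by (simp add: powr_minus divide_simps)
    have 2: "p powr - 0.1 \<le> Y powr - 0.1"
      using p assms by (intro powr_mono2') auto
    \<comment> \<open>The part \<open>p^-0.9\<close> is at most the inverse square of the order,
      because \<open>0.9 = 2 * 0.45\<close>; the part \<open>p^-0.1\<close> supplies the small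
      factor \<open>Y^-0.1\<close>.\<close>
    have "1 / real p = p powr - 0.1 * p powr - 0.9"
      using p1 by (simp add: powr_add [symmetric] powr_minus divide_simps)
    also have "\<dots> \<le> Y powr -0.1 * (1 / (ord p 2)\<^sup>2)"
      using 1 2 by (intro mult_mono) auto
    finally show "1 / real p \<le> Y powr -0.1 * (1 / (ord p 2)\<^sup>2)" .
  qed
  have "(\<Sum>p\<in>I. 1 / real p) = (\<Sum>m=1..N. \<Sum>p | p \<in> I \<and> ord p 2 = m. 1 / real p)"
    using finI ord(1) by (intro sum.group[symmetric]) auto
  also have "\<dots> \<le> (\<Sum>m=1..N. Y powr -0.1 * (1 / real m))"
  proof (rule sum_mono)
    fix m assume m: "m \<in> {1..N}"
    have "(\<Sum>p | p \<in> I \<and> ord p 2 = m. 1 / real p) \<le> (\<Sum>p | p \<in> I \<and> ord p 2 = m. Y powr -0.1 * (1 / m\<^sup>2))"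
      using ord(2) by (intro sum_mono) auto
    also have "\<dots> = card {p. p \<in> I \<and> ord p 2 = m} * (Y powr -0.1 * (1 / m\<^sup>2))" by simp
    also have "\<dots> \<le> m * (Y powr -0.1 * (1 / m\<^sup>2))"
      using m finI by (intro mult_right_mono of_nat_mono card_primes_ord_eq_le) (auto simp: I_def)
    also have "\<dots> = Y powr -0.1 * (1 / real m)" using m by (simp add: power2_eq_square)
    finally show "(\<Sum>p | p \<in> I \<and> ord p 2 = m. 1 / real p) \<le> Y powr -0.1 * (1 / real m)" .
  qed
  also have "\<dots> = Y powr -0.1 * (\<Sum>m=1..N. 1 / real m)" by (simp only: sum_distrib_left)
  also have "\<dots> \<le> Y powr -0.1 * (1 + ln N)"
    using sum_inverse_le[OF assms(1)] by (intro mult_left_mono) auto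
  finally have sumI: "(\<Sum>p\<in>I. 1 / real p) \<le> Y powr -0.1 * (1 + ln N)" .
  have "{n \<in> {1..N}. \<exists>p. prime p \<and> Y < real p \<and> p dvd n \<and> real (ord p 2) < p powr 0.45}
    \<subseteq> {n \<in> {1..N}. \<exists>p\<in>I. p dvd n}"
  proof safe
    fix n p assume n: "n \<in> {1..N}" and p: "prime p" "Y < real p" "p dvd n" "real (ord p 2) < p powr 0.45"
    have "p \<le> N" using p n by (auto dest!: dvd_imp_le)
    moreover have "p \<ge> 1" using p prime_ge_1_nat by blast
    ultimately show "\<exists>p\<in>I. p dvd n" using p by (intro bexI[of _ p]) (auto simp: I_def)
  qed
  then have "real (card {n \<in> {1..N}. \<exists>p. prime p \<and> Y < real p \<and> p dvd n \<and> real (ord p 2) < p powr 0.45})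
     \<le> real (card {n \<in> {1..N}. \<exists>p\<in>I. p dvd n})"
    by (intro of_nat_mono card_mono) auto
  also have "\<dots> \<le> N * (\<Sum>p\<in>I. 1 / real p)"
    using finI by (intro card_multiples_Union_le) (auto simp: I_def)
  also have "\<dots> \<le> N * (Y powr -0.1 * (1 + ln N))"
    using sumI by (intro mult_left_mono) auto
  finally show ?thesis .
qed

text \<open>With \<open>g\<close> the gcd, \<open>p q = (1 + g i) (1 + g j)\<close> divides
  \<open>n\<close>. A union bound over \<open>g \<ge> G\<close> and all \<open>i\<close>,
  \<open>j\<close> costs the sum of \<open>1 / (g^2 i j)\<close>, where \<open>g\<close> contributes
  \<open>2 / G\<close> and each of \<open>i\<close>, \<open>j\<close> a factor
  \<open>1 + ln N\<close>.\<close>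

lemma card_two_primes_large_gcd_le:
  fixes G :: real and N :: nat
  assumes "N \<ge> 1" "G > 0"
  shows "real (card {n \<in> {1..N}. \<exists>p q. prime p \<and> prime q \<and> p \<noteq> q \<and> p dvd n \<and> q dvd n \<and>
      G \<le> real (gcd (p - 1) (q - 1))}) \<le> N * (2 / G * (1 + ln N)\<^sup>2)"
proof -
  define J where "J = {g. g \<in> {1..N} \<and> G \<le> real g}"
  define I where "I = J \<times> ({1..N} \<times> {1..N})"
  define f where "f = (\<lambda>(g, (i, j)). (1 + g * i) * (1 + g * j) :: nat)"
  have finI: "finite I" by (simp add: I_def J_def)
  have "{n \<in> {1..N}. \<exists>p q. prime p \<and> prime q \<and> p \<noteq> q \<and> p dvd n \<and> q dvd n \<and> G \<le> real (gcd (p - 1) (q - 1))}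
    \<subseteq> {n \<in> {1..N}. \<exists>t\<in>I. f t dvd n}"
  proof safe
    fix n p q assume n: "n \<in> {1..N}" and pq: "prime p" "prime q" "p \<noteq> q" "p dvd n" "q dvd n"
      and G: "G \<le> real (gcd (p - 1) (q - 1))"
    define g where "g = gcd (p - 1) (q - 1)"
    have p2: "p \<ge> 2" "q \<ge> 2" using pq prime_ge_2_nat by auto
    obtain i j where ij: "p - 1 = g * i" "q - 1 = g * j" unfolding g_def by (meson dvdE gcd_dvd1 gcd_dvd2)
    have le: "p \<le> N" "q \<le> N" using pq n by (auto dest!: dvd_imp_le)
    have eq: "p = 1 + g * i" "q = 1 + g * j" using ij p2 by auto
    have pos: "g \<ge> 1" "i \<ge> 1" "j \<ge> 1" using ij p2 by (auto simp: Suc_le_eq intro!: Nat.gr0I)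
    have "g * 1 \<le> g * i" "1 * i \<le> g * i" "1 * j \<le> g * j" using pos by (intro mult_le_mono; simp)+
    then have "g \<le> N" "i \<le> N" "j \<le> N" using eq le by linarith+
    then have I: "(g, (i, j)) \<in> I" using pos G by (auto simp: I_def J_def g_def)
    have "p * q dvd n" using pq primes_coprime by (intro divides_mult) auto
    moreover have "f (g, (i, j)) = p * q" unfolding f_def eq by simp
    ultimately have "f (g, (i, j)) dvd n" by simp
    with I show "\<exists>t\<in>I. f t dvd n" by blast
  qed
  then have "real (card {n \<in> {1..N}. \<exists>p q. prime p \<and> prime q \<and> p \<noteq> q \<and> p dvd n \<and> q dvd n \<and> G \<le> real (gcd (p - 1) (q - 1))})
     \<le> real (card {n \<in> {1..N}. \<exists>t\<in>I. f t dvd n})"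
    by (intro of_nat_mono card_mono) auto
  also have "\<dots> \<le> N * (\<Sum>t\<in>I. 1 / real (f t))"
    using finI by (intro card_multiples_Union_le) (auto simp: f_def)
  also have "(\<Sum>t\<in>I. 1 / real (f t)) \<le> (\<Sum>(g, (i, j))\<in>I. 1 / (real g)\<^sup>2 * (1 / real i * (1 / real j)))"
  proof (rule sum_mono)
    fix t assume "t \<in> I"
    then obtain g i j where t: "t = (g, (i, j))" and pos: "g \<ge> 1" "i \<ge> 1" "j \<ge> 1"
      by (auto simp: I_def J_def)
    have "(g * i) * (g * j) \<le> f t" by (simp add: f_def t)
    then have "real ((g * i) * (g * j)) \<le> real (f t)" by (simp only: of_nat_le_iff)
    moreover have "real ((g * i) * (g * j)) > 0" using pos by simp
    ultimately have "1 / real (f t) \<le> 1 / real ((g * i) * (g * j))"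
      by (intro divide_left_mono mult_pos_pos) auto
    also have "\<dots> = 1 / (real g)\<^sup>2 * (1 / real i * (1 / real j))"
      by (simp add: power2_eq_square)
    finally show "1 / real (f t) \<le> (case t of (g, (i, j)) \<Rightarrow> 1 / (real g)\<^sup>2 * (1 / real i * (1 / real j)))"
      by (simp add: t)
  qed
  also have "\<dots> = (\<Sum>g\<in>J. 1 / (real g)\<^sup>2) * (\<Sum>i=1..N. 1 / real i)\<^sup>2"
    unfolding I_def power2_eq_square[of "sum _ _"] sum_product sum.cartesian_product
    by (simp add: sum.cartesian_product sum_product split_beta)
  also have "\<dots> \<le> 2 / G * (1 + ln N)\<^sup>2"
    using sum_inverse_squares_le[OF assms(2), of N] sum_inverse_le[OF assms(1)]
    by (intro mult_mono power_mono) (auto simp: J_def sum_nonneg less_imp_le[OF assms(2)])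
  finally show ?thesis by (simp add: mult_left_mono)
qed

section \<open>Products of large primes\<close>

lemma card_range_power_mod_ge:
  fixes p a :: nat
  assumes "coprime p a" "p > 0"
  shows "ord p a \<le> card (range (\<lambda>j. int a ^ j mod int p))"
proof -
  have "inj_on (\<lambda>j. int a ^ j mod int p) {..<ord p a}"
  proof (rule inj_onI)
    fix x y assume "x \<in> {..<ord p a}" "y \<in> {..<ord p a}" "int a ^ x mod int p = int a ^ y mod int p"
    then show "x = y"
      using inj_power_mod[OF assms(1)]
      by (auto dest!: inj_onD simp flip: of_nat_power of_nat_mod)
  qed
  moreover have "finite (range (\<lambda>j. int a ^ j mod int p))"
    by (rule finite_subset[of _ "{0..<int p}"]) (use assms in auto)
  ultimately show ?thesis
    by (metis card_inj_on_le card_lessThan image_mono subset_UNIV)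
qed

text \<open>The powers of \<open>2 ^ h\<close> modulo \<open>p\<close> form a group \<open>K\<close>
  of order \<open>ord p 2 / gcd h (ord p 2)\<close>, large enough for 0 to be a sum of 72 of its
  elements. Exponents divisible by \<open>h\<close> are what lets solutions for different primes be
  combined.\<close>

lemma exists_sum_powers_dvd:
  fixes p h :: nat
  assumes p: "prime p" "p \<ge> 4 ^ 100"
    and ord: "real (ord p 2) \<ge> gcd h (ord p 2) * p powr 0.44"
  shows "\<exists>j. p dvd (\<Sum>l<72::nat. 2 ^ (h * j l))"
proof -
  have "p \<noteq> 2" using p(2) by auto
  then have cop: "coprime p 2" using p(1) primes_coprime two_is_prime_nat by blast
  have p0: "p > 0" using p(1) prime_gt_0_nat by blast
  define K where "K = range (\<lambda>j. int (2 ^ h) ^ j mod int p)"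
  have "ord p (2 ^ h) * gcd h (ord p 2) = ord p 2" by (rule ord_power_aux)
  moreover have "gcd h (ord p 2) > 0" using cop p0 by (simp add: ord_eq_0)
  ultimately have "real (ord p (2 ^ h)) \<ge> p powr 0.44"
    using ord by (metis mult.commute mult_le_cancel_left_pos of_nat_0_less_iff of_nat_mult)
  also have "ord p (2 ^ h) \<le> card K"
    unfolding K_def using cop p0 by (intro card_range_power_mod_ge) auto
  finally have card: "real (card K) \<ge> real_of_int (int p) powr 0.44" by simp
  have "0 \<in> iter_sumset (int p) K 72"
  proof (rule zero_mem_iter_sumset)
    show "prime (int p)" using p by simp
    show "4 ^ 100 \<le> int p" using p(2) by (metis of_nat_le_iff of_nat_numeral of_nat_power)
    show "K \<subseteq> {0..<int p}" using p0 by (auto simp: K_def)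
    show "k * l mod int p \<in> K" if kl: "k \<in> K" "l \<in> K" for k l
    proof -
      obtain i j where "k = int (2 ^ h) ^ i mod int p" "l = int (2 ^ h) ^ j mod int p"
        using kl unfolding K_def by blast
      then have "k * l mod int p = int (2 ^ h) ^ (i + j) mod int p"
        by (simp add: mod_mult_eq power_add)
      then show ?thesis unfolding K_def by blast
    qed
  qed (rule card)
  then obtain g where g: "\<forall>l<72::nat. g l \<in> K" "0 = (\<Sum>l<72::nat. g l) mod int p"
    using iter_sumset_imp_sum by blast
  have "\<forall>l. \<exists>j. l < (72::nat) \<longrightarrow> g l = int (2 ^ h) ^ j mod int p"
    using g(1) unfolding K_def by blast
  then obtain j where j: "\<And>l. l < (72::nat) \<Longrightarrow> g l = int (2 ^ h) ^ j l mod int p" by metis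
  have "(\<Sum>l<72::nat. g l) mod int p = (\<Sum>l<72::nat. int (2 ^ h) ^ j l mod int p) mod int p"
    using j by (intro arg_cong[where f = "\<lambda>x. x mod int p"] sum.cong) auto
  also have "\<dots> = (\<Sum>l<72::nat. int (2 ^ h) ^ j l) mod int p" by (rule mod_sum_eq)
  also have "(\<Sum>l<72::nat. int (2 ^ h) ^ j l) = int (\<Sum>l<72::nat. 2 ^ (h * j l))" by (simp add: power_mult)
  finally have "int p dvd int (\<Sum>l<72::nat. 2 ^ (h * j l))" using g(2) by (simp add: dvd_eq_mod_eq_0)
  then show ?thesis by (intro exI) (simp only: int_dvd_int_iff)
qed

text \<open>The exponent \<open>h p\<close> below kills \<open>2\<close> modulo every prime of \<open>P\<close> other than \<open>p\<close>, so the
  exponents \<open>\<Sum>p\<in>P. h p * j p l\<close> can be adjusted independently modulo each prime.\<close>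

lemma min_weight_multiple_prod_primes_le:
  fixes P :: "nat set"
  assumes fin: "finite P" and P: "\<And>p. p \<in> P \<Longrightarrow> prime p \<and> p \<ge> 4 ^ 100"
    and ord: "\<And>p. p \<in> P \<Longrightarrow> real (ord p 2) \<ge> gcd (\<Prod>r\<in>P - {p}. r - 1) (ord p 2) * p powr 0.44"
  shows "min_weight_multiple (\<Prod>P) \<le> 72"
proof -
  define h where "h = (\<lambda>p. \<Prod>r\<in>P - {p}. r - 1)"
  have "\<forall>p. \<exists>j. p \<in> P \<longrightarrow> p dvd (\<Sum>l<72::nat. 2 ^ (h p * j l))"
    using exists_sum_powers_dvd P ord unfolding h_def by blast
  then obtain j where j: "\<And>p. p \<in> P \<Longrightarrow> p dvd (\<Sum>l<72::nat. 2 ^ (h p * j p l))" by metis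
  define b where "b = (\<lambda>l. \<Sum>p\<in>P. h p * j p l)"
  have cong: "[2 ^ b l = 2 ^ (h p * j p l)] (mod p)" if "p \<in> P" for p and l :: nat
  proof -
    have "p \<noteq> 2" "prime p" using P[OF that] by auto
    then have "\<not> p dvd 2" using primes_dvd_imp_eq two_is_prime_nat by blast
    then have fermat: "[2 ^ (p - 1) = 1] (mod p)" using \<open>prime p\<close> by (intro fermat_theorem)
    have "[(\<Prod>r\<in>P - {p}. 2 ^ (h r * j r l)) = (\<Prod>r\<in>P - {p}. 1)] (mod p)"
    proof (rule cong_prod)
      fix r assume "r \<in> P - {p}"
      \<comment> \<open>\<open>h r\<close> is a product over all primes of \<open>P\<close> but
        \<open>r\<close>, so for \<open>r \<noteq> p\<close> it contains the factor
        \<open>p - 1\<close>, and Fermat's theorem removes the power.\<close>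
      then have "p - 1 dvd h r" unfolding h_def using that fin by (intro dvd_prodI) auto
      then obtain m where "h r * j r l = (p - 1) * m" by (metis dvd_mult2 dvdE)
      then show "[2 ^ (h r * j r l) = 1] (mod p)"
        using cong_pow[OF fermat, of m] by (simp add: power_mult)
    qed
    then have "[2 ^ (h p * j p l) * (\<Prod>r\<in>P - {p}. 2 ^ (h r * j r l)) = 2 ^ (h p * j p l) * 1] (mod p)"
      by (intro cong_mult) auto
    moreover have "(2::nat) ^ b l = 2 ^ (h p * j p l) * (\<Prod>r\<in>P - {p}. 2 ^ (h r * j r l))"
      unfolding b_def power_sum using fin that by (rule prod.remove)
    ultimately show ?thesis by simp
  qed
  define Q where "Q = (\<Sum>l<72::nat. (2::nat) ^ b l)"
  have "\<Prod>P dvd Q"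
  proof -
    have "p dvd Q" if "p \<in> P" for p
    proof -
      have "[Q = (\<Sum>l<72::nat. 2 ^ (h p * j p l))] (mod p)"
        unfolding Q_def using cong[OF that] by (intro cong_sum)
      then show ?thesis using j[OF that] cong_dvd_iff by blast
    qed
    then show ?thesis using fin P by (intro prod_primes_dvd_of_dvd) auto
  qed
  moreover have "Q > 0" unfolding Q_def by (rule sum_pos2[of _ 0]) auto
  ultimately have "min_weight_multiple (\<Prod>P) \<le> hamming_weight Q" by (rule min_weight_multiple_le)
  also have "\<dots> \<le> 72" unfolding Q_def using hamming_weight_sum_pow2_le[of "{..<72::nat}" b] by simp
  finally show ?thesis .
qed

section \<open>Bounding the gcds and splitting off the small primes\<close>

lemma gcd_mult_dvd_mult_gcd:
  fixes a b m :: nat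
  shows "gcd (a * b) m dvd gcd a m * gcd b m"
proof -
  \<comment> \<open>The four products are the terms of \<open>gcd a m * gcd b m\<close> expanded by
    distributivity.\<close>
  have "gcd (a * b) m dvd gcd (gcd (a * b) (a * m)) (gcd (m * b) (m * m))"
    by (intro gcd_greatest) (auto intro: dvd_trans[OF gcd_dvd2])
  also have "\<dots> = gcd (a * gcd b m) (m * gcd b m)"
    by (simp only: gcd_mult_distrib_nat)
  also have "\<dots> = gcd a m * gcd b m"
    by (metis gcd_mult_distrib_nat mult.commute)
  finally show ?thesis .
qed

lemma gcd_prod_le:
  fixes f :: "'a \<Rightarrow> nat"
  assumes "m > 0" shows "gcd (\<Prod>i\<in>I. f i) m \<le> (\<Prod>i\<in>I. gcd (f i) m)"
proof (induction I rule: infinite_finite_induct)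
  case (insert i I)
  have "gcd (f i * (\<Prod>i\<in>I. f i)) m dvd gcd (f i) m * gcd (\<Prod>i\<in>I. f i) m"
    by (rule gcd_mult_dvd_mult_gcd)
  then have "gcd (f i * (\<Prod>i\<in>I. f i)) m \<le> gcd (f i) m * gcd (\<Prod>i\<in>I. f i) m"
    using assms by (intro dvd_imp_le) auto
  also have "\<dots> \<le> gcd (f i) m * (\<Prod>i\<in>I. gcd (f i) m)"
    using insert by (intro mult_left_mono) auto
  finally show ?case using insert by simp
qed auto

text \<open>The order of 2 divides \<open>p - 1\<close>, so its gcd with the product of the other
  \<open>r - 1\<close> is at most \<open>G ^ card P \<le> p^0.01\<close>. This accounts for the drop
  of the exponent from 0.45 to 0.44.\<close>

lemma min_weight_multiple_prod_primes_gcd_le: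
  fixes P :: "nat set" and G :: real
  assumes fin: "finite P" and G: "G \<ge> 1"
    and P: "\<And>p. p \<in> P \<Longrightarrow> prime p \<and> p \<ge> 4 ^ 100"
    and ord: "\<And>p. p \<in> P \<Longrightarrow> p powr 0.45 \<le> ord p 2"
    and gcd: "\<And>p q. p \<in> P \<Longrightarrow> q \<in> P \<Longrightarrow> p \<noteq> q \<Longrightarrow> real (gcd (p - 1) (q - 1)) \<le> G"
    and GP: "\<And>p. p \<in> P \<Longrightarrow> G ^ card P \<le> p powr 0.01"
  shows "min_weight_multiple (\<Prod>P) \<le> 72"
proof (rule min_weight_multiple_prod_primes_le)
  fix p assume p: "p \<in> P"
  then have pr: "prime p" and ge: "p \<ge> 4 ^ 100" using P by auto
  have "p \<noteq> 2" using ge by auto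
  then have "\<not> p dvd 2" using pr primes_dvd_imp_eq two_is_prime_nat by blast
  then have "[2 ^ (p - 1) = 1] (mod p)" using pr by (intro fermat_theorem)
  then have dvd: "ord p 2 dvd p - 1" by (simp only: ord_divides)
  have p1: "p - 1 > 0" using ge by (simp add: order_less_le_trans[of 1 "4 ^ 100"])
  have "gcd (\<Prod>r\<in>P - {p}. r - 1) (ord p 2) \<le> gcd (\<Prod>r\<in>P - {p}. r - 1) (p - 1)"
    using dvd p1 by (intro dvd_imp_le gcd_greatest) (auto intro: dvd_trans)
  also have "\<dots> \<le> (\<Prod>r\<in>P - {p}. gcd (r - 1) (p - 1))"
    using p1 by (rule gcd_prod_le)
  finally have "real (gcd (\<Prod>r\<in>P - {p}. r - 1) (ord p 2)) \<le> real (\<Prod>r\<in>P - {p}. gcd (r - 1) (p - 1))"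
    by (simp only: of_nat_le_iff)
  also have "\<dots> = (\<Prod>r\<in>P - {p}. real (gcd (r - 1) (p - 1)))" by (rule of_nat_prod)
  also have "\<dots> \<le> (\<Prod>r\<in>P - {p}. G)" using p by (intro prod_mono conjI gcd) auto
  also have "\<dots> = G ^ card (P - {p})" by simp
  also have "\<dots> \<le> G ^ card P" using G fin by (intro power_increasing card_mono) auto
  also have "\<dots> \<le> p powr 0.01" using p by (rule GP)
  finally have "gcd (\<Prod>r\<in>P - {p}. r - 1) (ord p 2) * p powr 0.44 \<le> p powr 0.01 * p powr 0.44"
    by (intro mult_right_mono) auto
  also have "\<dots> = p powr 0.45" by (simp add: powr_add [symmetric])
  also have "\<dots> \<le> ord p 2" using p by (rule ord)
  finally show "real (ord p 2) \<ge> gcd (\<Prod>r\<in>P - {p}. r - 1) (ord p 2) * p powr 0.44" .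
qed (use fin P in auto)

lemma power_multiplicity_le_cube:
  fixes n p :: nat and y :: real
  assumes n: "n > 0" and p: "p \<in> prime_factors n" "p \<le> y" and sq: "\<And>d. d\<^sup>2 dvd n \<Longrightarrow> d < y"
  shows "real (p ^ multiplicity p n) \<le> y ^ 3"
proof -
  define v where "v = multiplicity p n"
  have pr: "prime p" using p by auto
  have p1: "p \<ge> 1" using pr prime_ge_1_nat by blast
  then have y1: "y \<ge> 1" using p by linarith
  have dvd: "p ^ v dvd n" by (simp add: v_def multiplicity_dvd)
  show ?thesis
  proof (cases "v \<le> 1")
    case True
    then have "p ^ v \<le> p ^ 1" using p1 by (intro power_increasing)
    then have "real (p ^ v) \<le> y" using p by (metis of_nat_le_iff order_trans power_one_right)
    also have "y \<le> y ^ 3" using y1 self_le_power[of y 3] by simp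
    finally show ?thesis by (simp add: v_def)
  next
    case False
    \<comment> \<open>For \<open>v \<ge> 2\<close>, half of \<open>v\<close> rounded down is at
      least a third of \<open>v\<close>. The square of \<open>p ^ w\<close> divides
      \<open>n\<close>, so \<open>p ^ w < y\<close>, while its cube is at least
      \<open>p ^ v\<close>.\<close>
    define w where "w = v div 2"
    have w: "2 * w \<le> v" "v \<le> w * 3" using False unfolding w_def by linarith+
    have "(p ^ w)\<^sup>2 dvd p ^ v" using w by (simp add: le_imp_power_dvd flip: power_mult power_mult[of p w 2])
    then have "(p ^ w)\<^sup>2 dvd n" using dvd dvd_trans by blast
    then have "real (p ^ w) \<le> y" using sq by fastforce
    then have "real (p ^ w) ^ 3 \<le> y ^ 3" by (intro power_mono) auto
    moreover have "p ^ v \<le> p ^ (w * 3)" using w p1 by (intro power_increasing)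
    then have "real (p ^ v) \<le> real (p ^ w) ^ 3" by (metis of_nat_le_iff of_nat_power power_mult)
    ultimately show ?thesis by (simp add: v_def)
  qed
qed

text \<open>Primes above \<open>y\<close> divide \<open>n\<close> only to the first power, as
  \<open>p^2\<close> does not divide \<open>n\<close>, and together cost a factor 72. Each remaining
  prime power is at most \<open>y ^ 3\<close>, so the logarithmic bound suffices for their product
  \<open>s\<close>.\<close>

lemma min_weight_multiple_good_le:
  fixes n :: nat and y G :: real
  assumes n: "n > 0" and y: "y \<ge> 4 ^ 100" and G: "G \<ge> 1"
    and sq: "\<And>d. d\<^sup>2 dvd n \<Longrightarrow> d < y"
    and ord: "\<And>p. prime p \<Longrightarrow> p dvd n \<Longrightarrow> y < p \<Longrightarrow> p powr 0.45 \<le> ord p 2"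
    and gcd: "\<And>p q. prime p \<Longrightarrow> prime q \<Longrightarrow> p \<noteq> q \<Longrightarrow> p dvd n \<Longrightarrow> q dvd n \<Longrightarrow> real (gcd (p - 1) (q - 1)) \<le> G"
    and Gy: "G ^ card (prime_factors n) \<le> y powr 0.01"
  shows "real (min_weight_multiple n) \<le> 72 * (3 * card (prime_factors n) * ln y / ln 2 + 1)"
proof -
  define P where "P = {p \<in> prime_factors n. y < p}"
  define R where "R = {p \<in> prime_factors n. p \<le> y}"
  define s where "s = (\<Prod>p\<in>R. p ^ multiplicity p n)"
  have fin: "finite P" "finite R" by (auto simp: P_def R_def)
  have y1: "y \<ge> 1" using y by (rule order_trans[rotated]) simp
  have mult1: "p ^ multiplicity p n = p" if "p \<in> P" for p
  proof -
    have p: "prime p" "p dvd n" "y < p" using that by (auto simp: P_def)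
    have "\<not> p\<^sup>2 dvd n" using sq[of p] p by auto
    then have "multiplicity p n < 2" using p n by (meson multiplicity_dvd' not_le_imp_less)
    moreover have "multiplicity p n > 0" using p n by (simp add: prime_multiplicity_gt_zero_iff)
    ultimately have "multiplicity p n = 1" by linarith
    then show ?thesis by simp
  qed
  have "n = (\<Prod>p\<in>prime_factors n. p ^ multiplicity p n)"
    using n by (rule prime_factorization_nat)
  also have "prime_factors n = R \<union> P" by (auto simp: P_def R_def)
  also have "(\<Prod>p\<in>R \<union> P. p ^ multiplicity p n) = s * (\<Prod>p\<in>P. p ^ multiplicity p n)"
    unfolding s_def by (intro prod.union_disjoint fin) (auto simp: P_def R_def)
  also have "(\<Prod>p\<in>P. p ^ multiplicity p n) = \<Prod>P"
    using mult1 by (intro prod.cong) auto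
  finally have n_eq: "n = s * \<Prod>P" .
  with n have pos: "s > 0" "\<Prod>P > 0" by auto
  have "real s = (\<Prod>p\<in>R. real (p ^ multiplicity p n))" unfolding s_def by (rule of_nat_prod)
  also have "\<dots> \<le> (\<Prod>p\<in>R. y ^ 3)"
    using power_multiplicity_le_cube[OF n _ _ sq] by (intro prod_mono) (auto simp: R_def)
  also have "\<dots> = (y ^ 3) ^ card R" by simp
  also have "\<dots> \<le> (y ^ 3) ^ card (prime_factors n)"
    using y1 by (intro power_increasing card_mono) (auto simp: R_def)
  also have "\<dots> = y ^ (3 * card (prime_factors n))" by (simp only: power_mult)
  finally have "ln s \<le> ln (y ^ (3 * card (prime_factors n)))" using pos y1 by simp
  also have "\<dots> = 3 * card (prime_factors n) * ln y" using y1 by (simp add: ln_realpow)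
  finally have ln_s: "ln s \<le> 3 * card (prime_factors n) * ln y" .
  have "real (min_weight_multiple s) \<le> ln s / ln 2 + 1"
    using pos by (intro min_weight_multiple_le_log)
  also have "\<dots> \<le> 3 * card (prime_factors n) * ln y / ln 2 + 1"
    using ln_s by (simp add: divide_right_mono)
  finally have Ms: "real (min_weight_multiple s) \<le> 3 * card (prime_factors n) * ln y / ln 2 + 1" .
  have MP: "min_weight_multiple (\<Prod>P) \<le> 72"
  proof (rule min_weight_multiple_prod_primes_gcd_le[OF fin(1) G])
    fix p assume p: "p \<in> P"
    have "real (4 ^ 100) \<le> real p" using p y by (simp add: P_def)
    then have "4 ^ 100 \<le> p" by (simp only: of_nat_le_iff)
    moreover have "prime p" using p by (auto simp: P_def)
    ultimately show "prime p \<and> 4 ^ 100 \<le> p" by blast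
    show "p powr 0.45 \<le> ord p 2" using p by (intro ord) (auto simp: P_def)
    have "G ^ card P \<le> G ^ card (prime_factors n)"
      using G by (intro power_increasing card_mono) (auto simp: P_def)
    also have "\<dots> \<le> y powr 0.01" by (rule Gy)
    also have "\<dots> \<le> p powr 0.01" using p y1 by (intro powr_mono2) (auto simp: P_def)
    finally show "G ^ card P \<le> p powr 0.01" .
  next
    fix p q assume "p \<in> P" "q \<in> P" "p \<noteq> q"
    then show "real (gcd (p - 1) (q - 1)) \<le> G" by (intro gcd) (auto simp: P_def)
  qed
  have "min_weight_multiple n \<le> min_weight_multiple s * min_weight_multiple (\<Prod>P)"
    unfolding n_eq using pos by (rule min_weight_multiple_mult_le)
  also have "\<dots> \<le> min_weight_multiple s * 72" using MP by (rule mult_left_mono) simp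
  finally have "real (min_weight_multiple n) \<le> real (min_weight_multiple s * 72)" by (simp only: of_nat_le_iff)
  also have "\<dots> \<le> 72 * (3 * card (prime_factors n) * ln y / ln 2 + 1)" using Ms by simp
  finally show ?thesis .
qed

section \<open>The average\<close>

lemma half_le_ln_2: "1 / 2 \<le> ln (2::real)"
proof -
  have "ln (1 / 2 :: real) \<le> 1 / 2 - 1" by (rule ln_le_minus_one) simp
  then show ?thesis by (simp add: ln_div)
qed

text \<open>With \<open>L = ln x\<close> and \<open>w \<le> 4 ln L\<close> prime factors, the product of the gcds of \<open>p - 1\<close> with the
  other \<open>r - 1\<close> is at most \<open>(L\<^sup>3)\<^sup>w \<le> exp (12 (ln L)\<^sup>2) = y\<^bsup>0.01\<^esup>\<close>; this fixes the constant \<open>1200\<close>.\<close>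

definition exceptional :: "nat \<Rightarrow> real \<Rightarrow> nat set" where
  "exceptional N L = (let y = exp (1200 * (ln L)\<^sup>2) in
     {n \<in> {1..N}. \<exists>d. y \<le> real d \<and> d\<^sup>2 dvd n} \<union>
     {n \<in> {1..N}. L\<^sup>2 \<le> 2 ^ card (prime_factors n)} \<union>
     {n \<in> {1..N}. \<exists>p. prime p \<and> y < real p \<and> p dvd n \<and> real (ord p 2) < p powr 0.45} \<union>
     {n \<in> {1..N}. \<exists>p q. prime p \<and> prime q \<and> p \<noteq> q \<and> p dvd n \<and> q dvd n \<and> L ^ 3 \<le> real (gcd (p - 1) (q - 1))})"

text \<open>The thresholds give each class density \<open>O(1/L)\<close>, so that the trivial bound
  \<open>O(L)\<close> contributes only \<open>O(1)\<close> to the average. The 14 is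
  \<open>2 + 2 + 2 + 8\<close>.\<close>

lemma card_exceptional_le:
  fixes N :: nat and L :: real
  assumes N: "N \<ge> 1" "ln N \<le> L" and L: "ln L \<ge> 1"
  shows "real (card (exceptional N L)) \<le> 14 * N / L"
proof -
  define y where "y = exp (1200 * (ln L)\<^sup>2)"
  \<comment> \<open>Otherwise \<open>0 \<le> ln N \<le> L\<close> leaves only \<open>L = 0\<close>,
    where the default value \<open>ln 0 = 0\<close> contradicts \<open>ln L \<ge> 1\<close>.\<close>
  have L0: "L > 0"
  proof (rule ccontr)
    assume "\<not> L > 0"
    moreover have "0 \<le> ln N" using N by simp
    ultimately have "L = 0" using N by linarith
    then show False using L by simp
  qed
  then have L1: "L \<ge> 1" using L by (metis ln_ge_zero_iff order_trans zero_le_one)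
  have sq: "ln L \<le> (ln L)\<^sup>2" using L by (simp add: power2_eq_square)
  have "exp (ln L) \<le> y" unfolding y_def using sq L by (intro exp_le_cancel_iff[THEN iffD2]) linarith
  then have yL: "L \<le> y" using L0 by simp
  have y2: "y \<ge> 2"
  proof -
    have "1 + 1200 * (ln L)\<^sup>2 \<le> y" unfolding y_def by (rule exp_ge_add_one_self)
    then show ?thesis using sq L by linarith
  qed
  have lnN: "1 + ln N \<le> 2 * L" using N L1 by linarith
  have lnN0: "0 \<le> 1 + ln N" using N by simp
  define E1 where "E1 = {n \<in> {1..N}. \<exists>d. y \<le> real d \<and> d\<^sup>2 dvd n}"
  define E2 where "E2 = {n \<in> {1..N}. L\<^sup>2 \<le> 2 ^ card (prime_factors n)}"
  define E3 where "E3 = {n \<in> {1..N}. \<exists>p. prime p \<and> y < real p \<and> p dvd n \<and> real (ord p 2) < p powr 0.45}"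
  define E4 where "E4 = {n \<in> {1..N}. \<exists>p q. prime p \<and> prime q \<and> p \<noteq> q \<and> p dvd n \<and> q dvd n \<and> L ^ 3 \<le> real (gcd (p - 1) (q - 1))}"
  have E1: "real (card E1) \<le> N * (2 / L)"
  proof -
    have "real (card E1) \<le> N * (2 / y)"
      unfolding E1_def using y2 by (intro card_large_square_divisor_le) auto
    also have "\<dots> \<le> N * (2 / L)" using yL L0 y2 by (intro mult_left_mono divide_left_mono) auto
    finally show ?thesis .
  qed
  have E2: "real (card E2) \<le> N * (2 / L)"
  proof -
    have "real (card E2) \<le> N * (1 + ln N) / L\<^sup>2"
      unfolding E2_def using L0 N by (intro card_many_prime_factors_le) auto
    also have "\<dots> \<le> N * (2 * L) / L\<^sup>2"
      using lnN by (intro divide_right_mono mult_left_mono) auto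
    also have "\<dots> = N * (2 / L)" using L0 by (simp add: power2_eq_square)
    finally show ?thesis .
  qed
  have E3: "real (card E3) \<le> N * (2 / L)"
  proof -
    have "real (card E3) \<le> N * (y powr -0.1 * (1 + ln N))"
      unfolding E3_def using y2 N by (intro card_prime_divisor_small_order_le) auto
    also have "y powr -0.1 = exp (- (120 * (ln L)\<^sup>2))" by (simp add: y_def powr_def)
    also have "N * (exp (- (120 * (ln L)\<^sup>2)) * (1 + ln N)) \<le> N * (exp (- (2 * ln L)) * (2 * L))"
    proof -
      have "- (120 * (ln L)\<^sup>2) \<le> - (2 * ln L)" using sq L by linarith
      then show ?thesis using lnN lnN0 by (intro mult_left_mono mult_mono) auto
    qed
    also have "exp (- (2 * ln L)) = 1 / L\<^sup>2"
      using L0 by (simp add: exp_minus exp_double inverse_eq_divide)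
    also have "N * (1 / L\<^sup>2 * (2 * L)) = N * (2 / L)" using L0 by (simp add: power2_eq_square)
    finally show ?thesis .
  qed
  \<comment> \<open>The two harmonic sums cost \<open>(2 L)^2\<close>, hence the cube in the gcd
    threshold.\<close>
  have E4: "real (card E4) \<le> N * (8 / L)"
  proof -
    have "real (card E4) \<le> N * (2 / L ^ 3 * (1 + ln N)\<^sup>2)"
      unfolding E4_def using L0 N by (intro card_two_primes_large_gcd_le) auto
    also have "\<dots> \<le> N * (2 / L ^ 3 * (2 * L)\<^sup>2)"
      using lnN lnN0 L0 by (intro mult_left_mono power_mono) auto
    also have "\<dots> = N * (8 / L)" using L0 by (simp add: power2_eq_square power3_eq_cube)
    finally show ?thesis .
  qed
  have "exceptional N L = E1 \<union> E2 \<union> E3 \<union> E4"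
    by (simp add: exceptional_def Let_def E1_def E2_def E3_def E4_def y_def)
  then have "card (exceptional N L) \<le> card E1 + card E2 + card E3 + card E4"
    by (simp only:) (meson add_right_mono card_Un_le order_trans)
  then have "real (card (exceptional N L)) \<le> card E1 + card E2 + card E3 + card E4"
    by (simp only: of_nat_le_iff flip: of_nat_add)
  also have "\<dots> \<le> N * (2 / L) + N * (2 / L) + N * (2 / L) + N * (8 / L)"
    using E1 E2 E3 E4 by linarith
  also have "\<dots> = 14 * N / L" by (simp add: field_simps)
  finally show ?thesis .
qed

lemma min_weight_multiple_nonexceptional_le:
  assumes n: "n \<in> {1..N}" "n \<notin> exceptional N L" and L: "L > 0" "ln L \<ge> 1"
  shows "real (min_weight_multiple n) \<le> 2100000 * (ln L) ^ 3"
proof -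
  define l where "l = ln L"
  define y where "y = exp (1200 * l\<^sup>2)"
  define w where "w = real (card (prime_factors n))"
  have l: "l \<ge> 1" using L by (simp add: l_def)
  then have l2: "l\<^sup>2 \<ge> 1" by simp
  have L1: "L \<ge> 1" using L by (metis ln_ge_zero_iff order_trans zero_le_one)
  have ex: "n \<notin> {n \<in> {1..N}. \<exists>d. y \<le> real d \<and> d\<^sup>2 dvd n}"
     "n \<notin> {n \<in> {1..N}. L\<^sup>2 \<le> 2 ^ card (prime_factors n)}"
     "n \<notin> {n \<in> {1..N}. \<exists>p. prime p \<and> y < real p \<and> p dvd n \<and> real (ord p 2) < p powr 0.45}"
     "n \<notin> {n \<in> {1..N}. \<exists>p q. prime p \<and> prime q \<and> p \<noteq> q \<and> p dvd n \<and> q dvd n \<and> L ^ 3 \<le> real (gcd (p - 1) (q - 1))}"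
    using n(2) by (auto simp: exceptional_def Let_def y_def l_def)
  have "2 ^ card (prime_factors n) < L\<^sup>2" using ex(2) n(1) by auto
  then have "ln (2 ^ card (prime_factors n)) < ln (L\<^sup>2)"
    using L(1) by simp
  moreover have "ln ((2::real) ^ card (prime_factors n)) = w * ln 2"
    unfolding w_def by (rule ln_realpow)
  moreover have "ln (L\<^sup>2) = 2 * l" unfolding l_def by (simp add: ln_realpow)
  ultimately have "w * ln 2 < 2 * l" by simp
  \<comment> \<open>Turns \<open>w ln 2 < 2 l\<close> into the bound \<open>4 l\<close> on which the
    constant 1200 rests.\<close>
  moreover have "w * (1 / 2) \<le> w * ln 2" using half_le_ln_2 by (intro mult_left_mono) (auto simp: w_def)
  ultimately have w: "w \<le> 4 * l" by linarith
  have "real (min_weight_multiple n) \<le> 72 * (3 * card (prime_factors n) * ln y / ln 2 + 1)"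
  proof (rule min_weight_multiple_good_le)
    show "n > 0" using n by simp
    \<comment> \<open>Uses \<open>exp 3 \<ge> 1 + 3\<close>; then \<open>exp 300 \<le> y\<close>
      because \<open>l \<ge> 1\<close>.\<close>
    have "(4::real) ^ 100 \<le> exp 3 ^ 100"
      using exp_ge_add_one_self[of 3] by (intro power_mono) auto
    also have "\<dots> = exp 300" by (simp flip: exp_of_nat_mult)
    also have "\<dots> \<le> y" unfolding y_def using l2 by (intro exp_le_cancel_iff[THEN iffD2]) linarith
    finally show "4 ^ 100 \<le> y" .
    show "1 \<le> L ^ 3" using L1 by simp
    show "real d < y" if "d\<^sup>2 dvd n" for d
      by (rule ccontr) (use ex(1) n(1) that in \<open>simp only: not_less not_le mem_Collect_eq, blast intro: less_imp_le\<close>)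
    show "p powr 0.45 \<le> ord p 2" if "prime p" "p dvd n" "y < p" for p
      by (rule ccontr) (use ex(3) n(1) that in \<open>simp only: not_less not_le mem_Collect_eq, blast intro: less_imp_le\<close>)
    show "real (gcd (p - 1) (q - 1)) \<le> L ^ 3" if "prime p" "prime q" "p \<noteq> q" "p dvd n" "q dvd n" for p q
      by (rule ccontr) (use ex(4) n(1) that in \<open>simp only: not_less not_le mem_Collect_eq, blast intro: less_imp_le\<close>)
    have "(L ^ 3) ^ card (prime_factors n) = exp (l * (3 * w))"
    proof -
      have "L = exp l" using L by (simp add: l_def)
      then show ?thesis by (simp add: w_def mult_ac flip: exp_of_nat_mult)
    qed
    also have "\<dots> \<le> exp (12 * l\<^sup>2)"
      using w l mult_left_mono[of "3 * w" "12 * l" l] by (simp add: power2_eq_square)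
    also have "\<dots> = y powr 0.01" by (simp add: y_def powr_def)
    finally show "(L ^ 3) ^ card (prime_factors n) \<le> y powr 0.01" .
  qed
  \<comment> \<open>Here \<open>ln y = 1200 l^2\<close> and \<open>3 * 1200 = 3600\<close>. The
    leading constant becomes \<open>72 * 3600 * 8 = 2073600\<close>, and the remaining 72 is
    absorbed since \<open>l \<ge> 1\<close>.\<close>
  also have "\<dots> = 72 * (3600 * (w * (l\<^sup>2 / ln 2)) + 1)" by (simp add: w_def y_def)
  also have "\<dots> \<le> 72 * (3600 * ((4 * l) * (2 * l\<^sup>2)) + 1)"
  proof -
    have "l\<^sup>2 / ln 2 \<le> l\<^sup>2 / (1 / 2)" using half_le_ln_2 by (intro divide_left_mono) auto
    then have "w * (l\<^sup>2 / ln 2) \<le> (4 * l) * (2 * l\<^sup>2)"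
      using w l by (intro mult_mono) (auto simp: w_def)
    then show ?thesis by (intro mult_left_mono add_right_mono) simp_all
  qed
  also have "\<dots> = 2073600 * l ^ 3 + 72" by (simp add: power2_eq_square power3_eq_cube)
  also have "\<dots> \<le> 2100000 * l ^ 3" using one_le_power[OF l, of 3] by linarith
  finally show ?thesis by (simp add: l_def)
qed

lemma sum_min_weight_multiple_le:
  assumes N: "N \<ge> 1" "ln N \<le> L" and L: "L > 0" "ln L \<ge> 1"
  shows "(\<Sum>n=1..N. real (min_weight_multiple n)) \<le> N * (2100042 * (ln L) ^ 3)"
proof -
  have L1: "L \<ge> 1" using L by (metis ln_ge_zero_iff order_trans zero_le_one)
  have "(\<Sum>n=1..N. real (min_weight_multiple n))
    \<le> (\<Sum>n=1..N. 2100000 * (ln L) ^ 3 + (if n \<in> exceptional N L then 3 * L else 0))"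
  proof (rule sum_mono)
    fix n assume n: "n \<in> {1..N}"
    have pos: "0 \<le> 2100000 * (ln L) ^ 3" using L1 by simp
    show "real (min_weight_multiple n) \<le> 2100000 * (ln L) ^ 3 + (if n \<in> exceptional N L then 3 * L else 0)"
    proof (cases "n \<in> exceptional N L")
      case True
      have "ln n \<le> L" using n N by (intro order_trans[OF _ N(2)]) auto
      have "real (min_weight_multiple n) \<le> ln n / ln 2 + 1"
        using n by (intro min_weight_multiple_le_log) auto
      also have "\<dots> \<le> L / (1 / 2) + 1"
        using \<open>ln n \<le> L\<close> half_le_ln_2 L by (intro add_right_mono frac_le) auto
      also have "\<dots> \<le> 3 * L" using L1 by simp
      finally show ?thesis using pos unfolding if_P[OF True] by linarith
    next
      case False
      then show ?thesis using min_weight_multiple_nonexceptional_le[OF n False L] by simp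
    qed
  qed
  also have "\<dots> = N * (2100000 * (ln L) ^ 3) + real (card ({1..N} \<inter> exceptional N L)) * (3 * L)"
    by (simp add: sum.distrib sum.If_cases)
  also have "card ({1..N} \<inter> exceptional N L) \<le> card (exceptional N L)"
    by (intro card_mono) (auto simp: exceptional_def Let_def)
  also have "real (card (exceptional N L)) * (3 * L) \<le> 14 * N / L * (3 * L)"
    using card_exceptional_le[OF N L(2)] L by (intro mult_right_mono) auto
  \<comment> \<open>The exceptional integers contribute the constant \<open>14 * 3 = 42\<close> on
    average; \<open>1 ^ 3\<close> prepares its comparison with \<open>(ln L) ^ 3\<close>.\<close>
  also have "14 * N / L * (3 * L) = real N * (42 * 1 ^ 3)" using L by simp
  also have "\<dots> \<le> real N * (42 * ln L ^ 3)" using L by (intro mult_left_mono power_mono) auto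
  also have "N * (2100000 * (ln L) ^ 3) + N * (42 * ln L ^ 3) = N * (2100042 * (ln L) ^ 3)"
    by (simp add: algebra_simps)
  finally show ?thesis using L by (simp add: mult_right_mono)
qed

theorem theorem1:
  shows "\<exists>(C::real) (x0::real). C > 0 \<and>
    (\<forall>x::real. x \<ge> x0 \<longrightarrow>
      (1 / x) * (\<Sum>n | 1 \<le> n \<and> real n \<le> x. real (min_weight_multiple n)) \<le> C * (ln (ln x)) ^ 3)"
proof (rule exI[of _ "2100042"], rule exI[of _ "exp (exp 1)"], intro conjI allI impI)
  \<comment> \<open>The threshold \<open>exp (exp 1)\<close> is the point from which
    \<open>ln (ln x) \<ge> 1\<close>, as the bound with \<open>L = ln x\<close> requires.\<close>
  fix x :: real assume x: "exp (exp 1) \<le> x"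
  define N where "N = nat \<lfloor>x\<rfloor>"
  have "(0::real) < exp (exp 1)" by simp
  then have x0: "x > 0" using x by linarith
  have "ln (exp (exp 1)) \<le> ln x" using x x0 by (subst ln_le_cancel_iff) auto
  then have L: "exp 1 \<le> ln x" by simp
  have "(0::real) < exp 1" by simp
  then have L0: "ln x > 0" using L by linarith
  have "ln (exp 1) \<le> ln (ln x)" using L L0 by (subst ln_le_cancel_iff) auto
  then have LL: "1 \<le> ln (ln x)" by simp
  have "x \<ge> 1" using L0 x0 by (simp add: ln_gt_zero_iff)
  then have N: "N \<ge> 1" "real N \<le> x" by (simp_all add: N_def le_nat_iff)
  have "{n. 1 \<le> n \<and> real n \<le> x} = {1..N}"
    using x0 by (auto simp: N_def le_nat_iff le_floor_iff)
  then have "(\<Sum>n | 1 \<le> n \<and> real n \<le> x. real (min_weight_multiple n)) = (\<Sum>n=1..N. real (min_weight_multiple n))"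
    by simp
  also have "\<dots> \<le> N * (2100042 * (ln (ln x)) ^ 3)"
    using N L0 LL x0 by (intro sum_min_weight_multiple_le) auto
  also have "\<dots> \<le> x * (2100042 * (ln (ln x)) ^ 3)"
    using N LL by (intro mult_right_mono) auto
  finally show "(1 / x) * (\<Sum>n | 1 \<le> n \<and> real n \<le> x. real (min_weight_multiple n)) \<le> 2100042 * (ln (ln x)) ^ 3"
    using x0 by (simp add: field_simps)
qed simp

end
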